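(* (Two dimensions.) There is a constant $C>0$, independent of the number of levels $J$ and of the mesh sizes $h_k$, such that for any $u_{k,i}\in\mathcal K_{k,i}$ and $v_{l,j}\in\mathcal K_{l,j}$ ($k,l=1,\dots,J$, $i=1,\dots,N_k$, $j=1,\dots,N_l$), $$\sum_{k=1}^J\sum_{i=1}^{N_k}\sum_{(l,j)>(k,i)}(u_{k,i},v_{l,j})\le C\Big(\sum_{k=1}^J\sum_{i=1}^{N_k}\|u_{k,i}\|^2\Big)^{1/2}\Big(\sum_{l=1}^J\sum_{j=1}^{N_l}\|v_{l,j}\|^2\Big)^{1/2},$$ where $(l,j)>(k,i)$ means $l>k$, or $l=k$ and $j>i$.
   Context: $\Omega\subset\mathbb R^2$ is a polygon. $\mathcal T_1$ is a shape regular triangulation of $\Omega$; $\mathcal T_{k+1}$ is obtained from $\mathcal T_k$ by dividing each triangle into four congruent triangles, $k=1,\dots,J-1$; $h_k$ is the mesh size of $\mathcal T_k$, so $h_k/h_{k+1}=2$. The meshes are quasi-uniform. $(\cdot,\cdot)$ and $\|\cdot\|$ are the $L^2(\Omega)$ inner product and norm (scalar or vector). $\mathcal S_k\subset H_0^1(\Omega)$ is the space of continuous piecewise linear functions on $\mathcal T_k$, $N_k=\dim\mathcal S_k$; $\Phi_{k,i}$ is the one-dimensional space spanned by the $i$-th nodal basis function of $\mathcal S_k$, and $\mathcal K_{k,i}=\operatorname{curl}\Phi_{k,i}$, where $\operatorname{curl}$ of a scalar function is its rotated gradient. Constants may depend on $\Omega$ and on the initial triangulation $\mathcal T_1$. 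*)

theory Defs
  imports "HOL-Analysis.Analysis" "HOL-Library.Function_Algebras"
begin

subsection \<open>Polygons and meshes\<close>

text \<open>A polygon is a bounded polygonal domain: the boundary consists of finitely many segments.
  It may have holes; the condition \<^term>\<open>interior (closure \<Omega>) = \<Omega>\<close> excludes slits.\<close>

definition polygon :: "(real^2) set \<Rightarrow> bool" where
  "polygon \<Omega> \<longleftrightarrow> \<Omega> \<noteq> {} \<and> open \<Omega> \<and> connected \<Omega> \<and> bounded \<Omega> \<and> interior (closure \<Omega>) = \<Omega> \<and>
     (\<exists>E. finite E \<and> frontier \<Omega> = (\<Union>(a, b)\<in>E. closed_segment a b))"

text \<open>A mesh is a set of closed triangles. The predicate \<^const>\<open>triangulation\<close> gives finiteness and
  conformity (two triangles meet in a common face).\<close>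

definition triangulation_of :: "(real^2) set set \<Rightarrow> (real^2) set \<Rightarrow> bool" where
  "triangulation_of T \<Omega> \<longleftrightarrow> triangulation T \<and> (\<forall>K\<in>T. 2 simplex K) \<and> \<Union>T = closure \<Omega>"

definition mesh_size :: "(real^2) set set \<Rightarrow> real" where
  "mesh_size T = Max (diameter ` T)"

definition inradius :: "(real^2) set \<Rightarrow> real" where
  "inradius K = Sup {r. \<exists>x. cball x r \<subseteq> K}"

definition shape_regular :: "real \<Rightarrow> (real^2) set set \<Rightarrow> bool" where
  "shape_regular \<sigma> T \<longleftrightarrow> (\<forall>K\<in>T. diameter K \<le> \<sigma> * inradius K)"

definition quasi_uniform :: "real \<Rightarrow> (real^2) set set \<Rightarrow> bool" where
  "quasi_uniform \<mu> T \<longleftrightarrow> (\<forall>K\<in>T. mesh_size T \<le> \<mu> * diameter K)"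

text \<open>The four congruent subtriangles obtained by joining the edge midpoints. The vertices of a
  nondegenerate triangle are determined up to order, and the three corner triangles arise from the
  possible orders.\<close>

definition subtriangles :: "(real^2) set \<Rightarrow> (real^2) set set" where
  "subtriangles K = {K'. \<exists>a b c. K = convex hull {a, b, c} \<and>
     (K' = convex hull {a, midpoint a b, midpoint a c} \<or>
      K' = convex hull {midpoint a b, midpoint b c, midpoint c a})}"

definition refine_mesh :: "(real^2) set set \<Rightarrow> (real^2) set set" where
  "refine_mesh T = (\<Union>K\<in>T. subtriangles K)"

text \<open>Levels are counted from 1, so that \<open>mesh T 1 = T\<close>.\<close>

definition mesh :: "(real^2) set set \<Rightarrow> nat \<Rightarrow> (real^2) set set" where
  "mesh T k = (refine_mesh ^^ (k - 1)) T"

definition mesh_vertices :: "(real^2) set set \<Rightarrow> (real^2) set" where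
  "mesh_vertices T = (\<Union>K\<in>T. {x. x extreme_point_of K})"

subsection \<open>Gradient, curl and function spaces\<close>

text \<open>These are pointwise derivatives. For a continuous piecewise linear function they are meaningful
  off the edges, that is almost everywhere, and represent the weak derivatives; the unspecified
  values on the edges do not affect integrals.\<close>

definition grad :: "(real^2 \<Rightarrow> real) \<Rightarrow> real^2 \<Rightarrow> real^2" where
  "grad w x = (\<chi> i. frechet_derivative w (at x) (axis i 1))"

definition curl :: "(real^2 \<Rightarrow> real) \<Rightarrow> real^2 \<Rightarrow> real^2" where
  "curl w x = vector [grad w x $ 2, - (grad w x $ 1)]"

definition L2_inner :: "(real^2) set \<Rightarrow> (real^2 \<Rightarrow> 'a::euclidean_space) \<Rightarrow> (real^2 \<Rightarrow> 'a) \<Rightarrow> real" where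
  "L2_inner \<Omega> f g = (LINT x|lebesgue_on \<Omega>. f x \<bullet> g x)"

definition L2_norm :: "(real^2) set \<Rightarrow> (real^2 \<Rightarrow> 'a::euclidean_space) \<Rightarrow> real" where
  "L2_norm \<Omega> f = sqrt (L2_inner \<Omega> f f)"

text \<open>\<open>C\<^sup>\<infinity>\<close>: differentiable everywhere, with partial derivatives that are again \<open>C\<^sup>\<infinity>\<close>.\<close>

coinductive smooth :: "(real^2 \<Rightarrow> real) \<Rightarrow> bool" where
  "(\<And>x. f differentiable (at x)) \<Longrightarrow> (\<And>i. smooth (\<lambda>x. grad f x $ i)) \<Longrightarrow> smooth f"

definition test_functions :: "(real^2) set \<Rightarrow> (real^2 \<Rightarrow> real) set" where
  "test_functions \<Omega> = {f. smooth f \<and> (\<exists>K. compact K \<and> K \<subseteq> \<Omega> \<and> (\<forall>x. x \<notin> K \<longrightarrow> f x = 0))}"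

text \<open>\<open>H\<^sub>0\<^sup>1(\<Omega>)\<close> is the closure of the test functions in the \<open>H\<^sup>1\<close> norm. The limit \<open>g\<close> of the
  gradients is the weak gradient of \<open>w\<close>. The nonnegative integral is infinite if the integrand is
  not integrable, so convergence to 0 forces \<open>w\<close> and \<open>g\<close> to be square integrable.\<close>

definition H10 :: "(real^2) set \<Rightarrow> (real^2 \<Rightarrow> real) set" where
  "H10 \<Omega> = {w. w \<in> borel_measurable (lebesgue_on \<Omega>) \<and>
     (\<exists>g f. g \<in> borel_measurable (lebesgue_on \<Omega>) \<and> (\<forall>n::nat. f n \<in> test_functions \<Omega>) \<and>
        (\<lambda>n. \<integral>\<^sup>+x. ennreal ((f n x - w x)\<^sup>2) \<partial>lebesgue_on \<Omega>) \<longlonglongrightarrow> 0 \<and>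
        (\<lambda>n. \<integral>\<^sup>+x. ennreal ((norm (grad (f n) x - g x))\<^sup>2) \<partial>lebesgue_on \<Omega>) \<longlonglongrightarrow> 0)}"

subsection \<open>Finite elements\<close>

text \<open>Functions on the closure of \<open>\<Omega>\<close> are extended by 0, so that equality of finite element functions
  is equality of functions on the plane.\<close>

definition fe_space :: "(real^2) set \<Rightarrow> (real^2) set set \<Rightarrow> (real^2 \<Rightarrow> real) set" where
  "fe_space \<Omega> T = {w \<in> H10 \<Omega>. continuous_on (closure \<Omega>) w \<and>
     (\<forall>K\<in>T. \<exists>a b. \<forall>x\<in>K. w x = a \<bullet> x + b) \<and> (\<forall>x. x \<notin> closure \<Omega> \<longrightarrow> w x = 0)}"

definition fe_dim :: "(real^2) set \<Rightarrow> (real^2) set set \<Rightarrow> nat" where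
  "fe_dim \<Omega> T = vector_space.dim (\<lambda>c w x. c * w x) (fe_space \<Omega> T)"

text \<open>For a boundary vertex \<open>p\<close> no such function exists in \<^term>\<open>fe_space \<Omega> T\<close>, so there is one nodal
  basis function for each interior vertex.\<close>

definition nodal_basis :: "(real^2) set \<Rightarrow> (real^2) set set \<Rightarrow> (real^2 \<Rightarrow> real) set" where
  "nodal_basis \<Omega> T = {w \<in> fe_space \<Omega> T. \<exists>p\<in>mesh_vertices T.
     \<forall>q\<in>mesh_vertices T. w q = (if q = p then 1 else 0)}"

definition curl_line :: "(real^2 \<Rightarrow> real) \<Rightarrow> (real^2 \<Rightarrow> real^2) set" where
  "curl_line \<phi> = curl ` range (\<lambda>c x. c * \<phi> x)"

end

theory Submission
  imports Defs
begin

text \<open>On a triangle \<open>K\<close> of the initial mesh every nodal function is a scaled translate of one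
  hat function, written in barycentric coordinates of \<open>K\<close>. Let a nodal function of level \<open>k\<close> and one
  of level \<open>l \<ge> k\<close> be given. Since \<open>\<bar>\<nabla>\<phi>\<bar>\<close> is of order \<open>1 / h\<close>, the inner product of their gradients on
  \<open>K\<close> is \<open>O(2^(k - l))\<close>, while both norms are bounded below. If the fine node is interior to a
  coarse cell, the coarse gradient is constant on the fine patch and the fine gradient is odd about
  its node, so the inner product vanishes. Hence a coarse function interacts only with
  \<open>O(2^(l - k))\<close> fine nodes, those on the coarse grid lines, and a fine function with \<open>O(1)\<close> coarse
  ones. The Schur test with the weights \<open>(3/4)^(l - k)\<close> then bounds the whole bilinear form, because
  both resulting geometric series converge.\<close>

subsection \<open>Schur test\<close>

text \<open>The form is split over the fixed triangles of the initial mesh, because inside one of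
  them every level is a lattice and one affine frame serves all levels. The price is that the lower
  norm bound is not local: a nodal function may vanish on a given triangle. The local estimates are
  therefore phrased in scalar coefficients, whose squares are compared with the global norms through
  one triangle that contains the peak. A fine node on the boundary of an initial triangle has a
  truncated patch there and loses the odd symmetry. Since the sides of the triangle are themselves
  coarse grid lines, such a node is already among the exceptional ones. The weight is forced by the
  asymmetry of the counts: without it a row receives a contribution of order 1 from every finer
  level, hence grows with the number of levels, while the column contributions decay like 2^(k - l).
  Any weight q^(l - k) with 1/2 < q < 1 shares out this surplus decay.\<close>

lemma schur_test:
  fixes a r :: "'x \<Rightarrow> 'y \<Rightarrow> real" and c :: "'x \<Rightarrow> real" and d :: "'y \<Rightarrow> real"
  assumes "finite X" "finite Y"
    and a: "\<And>x y. x \<in> X \<Longrightarrow> y \<in> Y \<Longrightarrow> 0 \<le> a x y"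
    and r: "\<And>x y. x \<in> X \<Longrightarrow> y \<in> Y \<Longrightarrow> 0 < r x y"
    and rows: "\<And>x. x \<in> X \<Longrightarrow> (\<Sum>y\<in>Y. a x y * r x y) \<le> S"
    and cols: "\<And>y. y \<in> Y \<Longrightarrow> (\<Sum>x\<in>X. a x y / r x y) \<le> S"
    and "0 \<le> S"
  shows "(\<Sum>x\<in>X. \<Sum>y\<in>Y. a x y * \<bar>c x\<bar> * \<bar>d y\<bar>) \<le> S * sqrt (\<Sum>x\<in>X. (c x)\<^sup>2) * sqrt (\<Sum>y\<in>Y. (d y)\<^sup>2)"
proof -
  \<comment> \<open>The kernel factors as \<open>sqrt (a * r) * sqrt (a / r)\<close>. Cauchy-Schwarz
    on the product index set then leaves weighted row sums next to \<open>c\<close> and inversely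
    weighted column sums next to \<open>d\<close>.\<close>
  let ?f = "\<lambda>(x, y). sqrt (a x y * r x y) * \<bar>c x\<bar>"
  let ?g = "\<lambda>(x, y). sqrt (a x y / r x y) * \<bar>d y\<bar>"
  have "(\<Sum>x\<in>X. \<Sum>y\<in>Y. a x y * \<bar>c x\<bar> * \<bar>d y\<bar>) = (\<Sum>p\<in>X \<times> Y. ?f p * ?g p)"
    unfolding sum.cartesian_product
  proof (rule sum.cong[OF refl], clarify)
    fix x y assume "x \<in> X" "y \<in> Y"
    then have "0 \<le> a x y" "0 < r x y" using a r by auto
    then have "sqrt (a x y * r x y) * sqrt (a x y / r x y) = a x y"
      by (simp flip: real_sqrt_mult)
    then have "a x y * \<bar>c x\<bar> * \<bar>d y\<bar>
        = (sqrt (a x y * r x y) * sqrt (a x y / r x y)) * (\<bar>c x\<bar> * \<bar>d y\<bar>)"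
      by simp
    also have "\<dots> = sqrt (a x y * r x y) * \<bar>c x\<bar> * (sqrt (a x y / r x y) * \<bar>d y\<bar>)"
      by (simp only: mult_ac)
    finally show "a x y * \<bar>c x\<bar> * \<bar>d y\<bar>
        = sqrt (a x y * r x y) * \<bar>c x\<bar> * (sqrt (a x y / r x y) * \<bar>d y\<bar>)" .
  qed
  also have "\<dots> \<le> (\<Sum>p\<in>X \<times> Y. \<bar>?f p\<bar> * \<bar>?g p\<bar>)"
    unfolding abs_mult[symmetric] by (intro sum_mono abs_ge_self)
  also have "\<dots> \<le> L2_set ?f (X \<times> Y) * L2_set ?g (X \<times> Y)"
    by (rule L2_set_mult_ineq)
  also have "\<dots> \<le> sqrt (S * (\<Sum>x\<in>X. (c x)\<^sup>2)) * sqrt (S * (\<Sum>y\<in>Y. (d y)\<^sup>2))"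
  proof (rule mult_mono)
    have "(\<Sum>p\<in>X \<times> Y. (?f p)\<^sup>2) = (\<Sum>x\<in>X. \<Sum>y\<in>Y. a x y * r x y * (c x)\<^sup>2)"
      unfolding sum.cartesian_product using a r
      by (intro sum.cong) (auto simp: power_mult_distrib less_imp_le)
    also have "\<dots> = (\<Sum>x\<in>X. (\<Sum>y\<in>Y. a x y * r x y) * (c x)\<^sup>2)"
      by (simp add: sum_distrib_right)
    also have "\<dots> \<le> (\<Sum>x\<in>X. S * (c x)\<^sup>2)"
      using rows by (intro sum_mono mult_right_mono) auto
    finally show "L2_set ?f (X \<times> Y) \<le> sqrt (S * (\<Sum>x\<in>X. (c x)\<^sup>2))"
      unfolding L2_set_def by (simp add: sum_distrib_left)
    have "(\<Sum>p\<in>X \<times> Y. (?g p)\<^sup>2) = (\<Sum>x\<in>X. \<Sum>y\<in>Y. a x y / r x y * (d y)\<^sup>2)"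
      unfolding sum.cartesian_product using a r
      by (intro sum.cong) (auto simp: power_mult_distrib less_imp_le)
    also have "\<dots> = (\<Sum>y\<in>Y. (\<Sum>x\<in>X. a x y / r x y) * (d y)\<^sup>2)"
      by (subst sum.swap) (simp add: sum_distrib_right)
    also have "\<dots> \<le> (\<Sum>y\<in>Y. S * (d y)\<^sup>2)"
      using cols by (intro sum_mono mult_right_mono) auto
    finally show "L2_set ?g (X \<times> Y) \<le> sqrt (S * (\<Sum>y\<in>Y. (d y)\<^sup>2))"
      unfolding L2_set_def by (simp add: sum_distrib_left)
  qed (use \<open>0 \<le> S\<close> in \<open>auto intro!: mult_nonneg_nonneg sum_nonneg L2_set_nonneg\<close>)
  also have "\<dots> = S * sqrt (\<Sum>x\<in>X. (c x)\<^sup>2) * sqrt (\<Sum>y\<in>Y. (d y)\<^sup>2)"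
    using \<open>0 \<le> S\<close> by (simp add: real_sqrt_mult)
  finally show ?thesis .
qed

text \<open>An injective exponent covers both uses, \<open>l - k\<close> with \<open>k\<close> fixed
  and with \<open>l\<close> fixed. Reindexing gives a partial sum of the geometric series, so the
  bound does not see the number of levels.\<close>

lemma geometric_tail_le:
  fixes q :: real
  assumes "0 \<le> q" "q < 1" "finite L" "inj_on f L"
  shows "(\<Sum>l\<in>L. q ^ f l) \<le> 1 / (1 - q)"
proof -
  have "(\<Sum>l\<in>L. q ^ f l) = (\<Sum>m\<in>f ` L. q ^ m)"
    using assms by (simp add: sum.reindex)
  also have "\<dots> \<le> (\<Sum>m. q ^ m)"
    using assms by (intro sum_le_suminf summable_geometric) auto
  also have "\<dots> = 1 / (1 - q)"
    using assms by (intro suminf_geometric) auto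
  finally show ?thesis .
qed

lemma multilevel_schur:
  fixes A :: "nat \<Rightarrow> nat \<Rightarrow> nat \<Rightarrow> nat \<Rightarrow> real" and c d :: "nat \<Rightarrow> nat \<Rightarrow> real"
    and N :: "nat \<Rightarrow> nat" and B M :: real
  assumes B: "0 \<le> B" and M: "0 \<le> M"
    and bound: "\<And>k i l j. \<lbrakk>k \<in> {1..J}; l \<in> {1..J}; k \<le> l; i \<in> {1..N k}; j \<in> {1..N l}\<rbrakk>
        \<Longrightarrow> \<bar>A k i l j\<bar> \<le> (if R k i l j then B / 2 ^ (l - k) else 0)"
    and rows: "\<And>k i l. \<lbrakk>k \<in> {1..J}; l \<in> {1..J}; k \<le> l; i \<in> {1..N k}\<rbrakk>
        \<Longrightarrow> real (card {j \<in> {1..N l}. R k i l j}) \<le> M * 2 ^ (l - k)"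
    and cols: "\<And>k l j. \<lbrakk>k \<in> {1..J}; l \<in> {1..J}; k \<le> l; j \<in> {1..N l}\<rbrakk>
        \<Longrightarrow> real (card {i \<in> {1..N k}. R k i l j}) \<le> M"
  shows "(\<Sum>k=1..J. \<Sum>i=1..N k.
        \<Sum>(l, j)\<in>{(l, j). l \<in> {1..J} \<and> j \<in> {1..N l} \<and> (l > k \<or> l = k \<and> j > i)}.
          c k i * d l j * A k i l j)
      \<le> 4 * B * M * sqrt (\<Sum>k=1..J. \<Sum>i=1..N k. (c k i)\<^sup>2) * sqrt (\<Sum>l=1..J. \<Sum>j=1..N l. (d l j)\<^sup>2)"
proof -
  let ?X = "Sigma {1..J} (\<lambda>k. {1..N k})"
  define a where "a = (\<lambda>(k, i) (l, j). if k \<le> l \<and> R k i l j then B / 2 ^ (l - k) else 0)"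
  \<comment> \<open>With \<open>m = l - k\<close>, one level contributes at most
    \<open>B * M * (3/4)^m\<close> to a row and \<open>B * M * (2/3)^m\<close> to a column. The
    series sum to 4 and 3, whence the factor 4. For \<open>l < k\<close> the truncated difference
    gives weight 1, where \<open>a\<close> vanishes.\<close>
  define r :: "nat \<times> nat \<Rightarrow> nat \<times> nat \<Rightarrow> real"
    where "r = (\<lambda>(k, i) (l, j). (3 / 4) ^ (l - k))"
  have fin: "finite ?X" by auto
  have a0: "0 \<le> a x y" for x y
    using B by (auto simp: a_def split: prod.splits)
  have "(\<Sum>k=1..J. \<Sum>i=1..N k.
        \<Sum>(l, j)\<in>{(l, j). l \<in> {1..J} \<and> j \<in> {1..N l} \<and> (l > k \<or> l = k \<and> j > i)}.
          c k i * d l j * A k i l j)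
      \<le> (\<Sum>k=1..J. \<Sum>i=1..N k. \<Sum>y\<in>?X. a (k, i) y * \<bar>c k i\<bar> * \<bar>case_prod d y\<bar>)"
  proof (intro sum_mono)
    fix k i assume k: "k \<in> {1..J}" and i: "i \<in> {1..N k}"
    let ?P = "{(l, j). l \<in> {1..J} \<and> j \<in> {1..N l} \<and> (l > k \<or> l = k \<and> j > i)}"
    have "(\<Sum>(l, j)\<in>?P. c k i * d l j * A k i l j)
        \<le> (\<Sum>y\<in>?P. a (k, i) y * \<bar>c k i\<bar> * \<bar>case_prod d y\<bar>)"
    proof (rule sum_mono)
      fix y assume "y \<in> ?P"
      then obtain l j where y: "y = (l, j)"
        and l: "l \<in> {1..J}" "j \<in> {1..N l}" "l > k \<or> l = k \<and> j > i" by auto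
      then have "\<bar>A k i l j\<bar> \<le> a (k, i) (l, j)"
        using bound[OF k l(1) _ i l(2)] by (auto simp: a_def)
      then have "\<bar>c k i * d l j\<bar> * \<bar>A k i l j\<bar> \<le> \<bar>c k i * d l j\<bar> * a (k, i) (l, j)"
        by (rule mult_left_mono) simp
      moreover have "c k i * d l j * A k i l j \<le> \<bar>c k i * d l j\<bar> * \<bar>A k i l j\<bar>"
        unfolding abs_mult[symmetric] by (rule abs_ge_self)
      ultimately have "c k i * d l j * A k i l j \<le> \<bar>c k i * d l j\<bar> * a (k, i) (l, j)"
        by (rule order.trans[rotated])
      then show "(case y of (l, j) \<Rightarrow> c k i * d l j * A k i l j) \<le> a (k, i) y * \<bar>c k i\<bar> * \<bar>case_prod d y\<bar>"
        by (simp add: abs_mult mult_ac y)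
    qed
    \<comment> \<open>The larger index set adds lower levels, where \<open>a\<close> is 0, and the
      pairs with \<open>j \<le> i\<close> on the same level, whose terms are nonnegative.\<close>
    also have "\<dots> \<le> (\<Sum>y\<in>?X. a (k, i) y * \<bar>c k i\<bar> * \<bar>case_prod d y\<bar>)"
      by (rule sum_mono2[OF fin]) (auto intro!: mult_nonneg_nonneg a0)
    finally show "(\<Sum>(l, j)\<in>?P. c k i * d l j * A k i l j)
        \<le> (\<Sum>y\<in>?X. a (k, i) y * \<bar>c k i\<bar> * \<bar>case_prod d y\<bar>)" .
  qed
  also have "\<dots> = (\<Sum>x\<in>?X. \<Sum>y\<in>?X. a x y * \<bar>case_prod c x\<bar> * \<bar>case_prod d y\<bar>)"
    by (subst sum.Sigma) (auto simp: case_prod_beta)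
  also have "\<dots> \<le> (4 * B * M) * sqrt (\<Sum>x\<in>?X. (case_prod c x)\<^sup>2) * sqrt (\<Sum>y\<in>?X. (case_prod d y)\<^sup>2)"
  proof (rule schur_test[where r = r])
    fix x assume "x \<in> ?X"
    then obtain k i where x: "x = (k, i)" and k: "k \<in> {1..J}" and i: "i \<in> {1..N k}" by auto
    have "(\<Sum>y\<in>?X. a x y * r x y) = (\<Sum>l=1..J. \<Sum>j=1..N l. a x (l, j) * r x (l, j))"
      by (subst sum.Sigma) (auto simp: case_prod_beta)
    also have "\<dots> \<le> (\<Sum>l=1..J. if k \<le> l then B * M * (3 / 4) ^ (l - k) else 0)"
    proof (rule sum_mono)
      fix l assume l: "l \<in> {1..J}"
      show "(\<Sum>j=1..N l. a x (l, j) * r x (l, j)) \<le> (if k \<le> l then B * M * (3 / 4) ^ (l - k) else 0)"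
      proof (cases "k \<le> l")
        case True
        have "(\<Sum>j=1..N l. a x (l, j) * r x (l, j))
            = (\<Sum>j=1..N l. if R k i l j then B / 2 ^ (l - k) * (3 / 4) ^ (l - k) else 0)"
          using True by (intro sum.cong) (auto simp: a_def r_def x)
        also have "\<dots> = real (card {j \<in> {1..N l}. R k i l j}) * (B / 2 ^ (l - k) * (3 / 4) ^ (l - k))"
          by (simp add: sum.If_cases Int_def)
        also have "\<dots> \<le> (M * 2 ^ (l - k)) * (B / 2 ^ (l - k) * (3 / 4) ^ (l - k))"
          using rows[OF k l True i] B by (intro mult_right_mono) auto
        finally show ?thesis using True by (simp add: mult_ac)
      qed (simp add: a_def x)
    qed
    also have "\<dots> = B * M * (\<Sum>l\<in>{k..J}. (3 / 4) ^ (l - k))"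
      using k by (subst sum.inter_filter[symmetric]) (auto simp: sum_distrib_left intro!: sum.cong)
    also have "\<dots> \<le> B * M * (1 / (1 - 3 / 4))"
      using B M by (intro mult_left_mono geometric_tail_le) (auto simp: inj_on_def)
    finally show "(\<Sum>y\<in>?X. a x y * r x y) \<le> 4 * B * M" by simp
  next
    fix y assume "y \<in> ?X"
    then obtain l j where y: "y = (l, j)" and l: "l \<in> {1..J}" and j: "j \<in> {1..N l}" by auto
    have "(\<Sum>x\<in>?X. a x y / r x y) = (\<Sum>k=1..J. \<Sum>i=1..N k. a (k, i) y / r (k, i) y)"
      by (subst sum.Sigma) (auto simp: case_prod_beta)
    also have "\<dots> \<le> (\<Sum>k=1..J. if k \<le> l then B * M * (2 / 3) ^ (l - k) else 0)"
    proof (rule sum_mono)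
      fix k assume k: "k \<in> {1..J}"
      show "(\<Sum>i=1..N k. a (k, i) y / r (k, i) y) \<le> (if k \<le> l then B * M * (2 / 3) ^ (l - k) else 0)"
      proof (cases "k \<le> l")
        case True
        have p: "B / 2 ^ (l - k) / (3 / 4) ^ (l - k) = B * (2 / 3) ^ (l - k)"
        proof -
          have "(2::real) ^ (l - k) * (3 / 4) ^ (l - k) = (3 / 2) ^ (l - k)"
            by (simp flip: power_mult_distrib)
          moreover have "(2 / 3 :: real) ^ (l - k) * (3 / 2) ^ (l - k) = 1"
            by (simp flip: power_mult_distrib)
          ultimately show ?thesis by (simp add: divide_simps mult_ac)
        qed
        have "(\<Sum>i=1..N k. a (k, i) y / r (k, i) y)
            = (\<Sum>i=1..N k. if R k i l j then B * (2 / 3) ^ (l - k) else 0)"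
          using True by (intro sum.cong) (auto simp: a_def r_def y p[unfolded divide_divide_eq_left])
        also have "\<dots> = real (card {i \<in> {1..N k}. R k i l j}) * (B * (2 / 3) ^ (l - k))"
          by (simp add: sum.If_cases Int_def)
        also have "\<dots> \<le> M * (B * (2 / 3) ^ (l - k))"
          using cols[OF k l True j] B by (intro mult_right_mono) auto
        finally show ?thesis using True by (simp add: mult_ac)
      qed (simp add: a_def y)
    qed
    also have "\<dots> = B * M * (\<Sum>k\<in>{1..l}. (2 / 3) ^ (l - k))"
      using l by (subst sum.inter_filter[symmetric]) (auto simp: sum_distrib_left intro!: sum.cong)
    also have "\<dots> \<le> B * M * (1 / (1 - 2 / 3))"
      using B M by (intro mult_left_mono geometric_tail_le) (auto simp: inj_on_def)
    also have "\<dots> \<le> 4 * B * M" using mult_nonneg_nonneg[OF B M] by simp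
    finally show "(\<Sum>x\<in>?X. a x y / r x y) \<le> 4 * B * M" .
  qed (use B M a0 in \<open>auto simp: r_def\<close>)
  also have "\<dots> = 4 * B * M * sqrt (\<Sum>k=1..J. \<Sum>i=1..N k. (c k i)\<^sup>2) * sqrt (\<Sum>l=1..J. \<Sum>j=1..N l. (d l j)\<^sup>2)"
    by (simp add: sum.Sigma case_prod_beta)
  finally show ?thesis .
qed

subsection \<open>Hat functions on a triangle\<close>

text \<open>The point reflection at \<open>q\<close> preserves Lebesgue measure, so the integral
  equals its own negative. Both steps also hold for nonintegrable \<open>f\<close>, whose integral
  is 0 by convention.\<close>

lemma integral_lborel_odd:
  fixes f :: "'a::euclidean_space \<Rightarrow> real"
  assumes [measurable]: "f \<in> borel_measurable borel"
    and odd: "\<And>z. f (2 *\<^sub>R q - z) = - f z"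
  shows "integral\<^sup>L lborel f = 0"
proof -
  have "integral\<^sup>L lborel f
      = integral\<^sup>L (density (distr lborel borel (\<lambda>x. 2 *\<^sub>R q + (-1) *\<^sub>R x)) (\<lambda>_. \<bar>-1::real\<bar> ^ DIM('a))) f"
    by (subst lborel_affine[of "-1" "2 *\<^sub>R q"]) auto
  also have "\<dots> = integral\<^sup>L lborel (\<lambda>x. f (2 *\<^sub>R q - x))"
    by (simp add: density_1 integral_distr)
  also have "\<dots> = - integral\<^sup>L lborel f"
    by (simp add: odd)
  finally show ?thesis by simp
qed

lemma integrable_cube:
  "integrable lborel (\<lambda>z. c * indicator (cbox p q) z :: real)" for p q :: "'a::euclidean_space"
  by (intro integrable_mult_right integrable_real_indicator) (simp_all add: emeasure_lborel_cbox_finite[unfolded infinity_ennreal_def])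

text \<open>Axis-parallel squares stand in for the affine patches in the area estimates,
  circumscribed for upper bounds and inscribed for lower ones, so that no Jacobian has to be
  computed.\<close>

lemma measure_lborel_cube:
  fixes q :: "real^2"
  assumes "0 \<le> r"
  shows "measure lborel (cbox (q - vec r) (q + vec r)) = (2 * r)\<^sup>2"
proof -
  have "q \<in> cbox (q - vec r) (q + vec r)"
    using assms by (simp add: mem_box_cart)
  then have "cbox (q - vec r) (q + vec r) \<noteq> {}" by blast
  then show ?thesis
    by (subst content_cbox_cart) (simp_all add: UNIV_2 power2_eq_square)
qed

text \<open>The first partial derivative of the hat function
  \<open>\<lambda>(s, t). max 0 (1 - (\<bar>s\<bar> + \<bar>t\<bar> + \<bar>s + t\<bar>) / 2)\<close> of the hexagonal patch around the origin; by symmetry the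
  second one is \<open>hat_slope t s\<close>. The values on the lines of nondifferentiability are chosen such
  that the function is odd everywhere.\<close>

definition hat_slope :: "real \<Rightarrow> real \<Rightarrow> real" where
  "hat_slope s t = (if \<bar>s\<bar> < 1 \<and> \<bar>t\<bar> < 1 \<and> \<bar>s + t\<bar> < 1 then - (sgn s + sgn (s + t)) / 2 else 0)"

lemma hat_slope_minus: "hat_slope (- s) (- t) = - hat_slope s t"
proof -
  have *: "- s - t = - (s + t)" by simp
  show ?thesis
    by (simp add: hat_slope_def * sgn_minus del: minus_add_distrib)
qed

lemma abs_hat_slope_le: "\<bar>hat_slope s t\<bar> \<le> 1"
  by (auto simp: hat_slope_def sgn_if)

text \<open>The constant values on three of the six triangles of the hexagonal patch. With the
  arguments exchanged they give both partial derivatives on the pieces needed for the lower energy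
  bound.\<close>

lemma hat_slope_corner: "\<lbrakk>0 < s; 0 < t; s + t < 1\<rbrakk> \<Longrightarrow> hat_slope s t = - 1"
  and hat_slope_left: "\<lbrakk>- 1 < s; 0 < t; s + t < 0\<rbrakk> \<Longrightarrow> hat_slope s t = 1"
  and hat_slope_below: "\<lbrakk>0 < s; - 1 < t; s + t < 0\<rbrakk> \<Longrightarrow> hat_slope s t = 0"
  by (auto simp: hat_slope_def sgn_if abs_less_iff)

lemma hat_slope_eq_0: "\<not> (\<bar>s\<bar> < 1 \<and> \<bar>t\<bar> < 1) \<Longrightarrow> hat_slope s t = 0"
  by (auto simp: hat_slope_def)

lemma hat_slope_measurable [measurable (raw)]:
  assumes [measurable]: "f \<in> borel_measurable M" "g \<in> borel_measurable M"
  shows "(\<lambda>x. hat_slope (f x) (g x)) \<in> borel_measurable M"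
  unfolding hat_slope_def by measurable

text \<open>The linear functionals \<open>d1\<close>, \<open>d2\<close> are dual to the edge vectors \<open>e1\<close>, \<open>e2\<close> of a triangle with
  vertex \<open>a\<close>; the coordinates below are two of its barycentric coordinates.\<close>

locale triangle_frame =
  fixes a e1 e2 d1 d2 :: "real^2"
  assumes dual: "d1 \<bullet> e1 = 1" "d1 \<bullet> e2 = 0" "d2 \<bullet> e1 = 0" "d2 \<bullet> e2 = 1"
    and expand: "\<And>h. h = (d1 \<bullet> h) *\<^sub>R e1 + (d2 \<bullet> h) *\<^sub>R e2"
begin

definition cx :: "real^2 \<Rightarrow> real" where "cx z = d1 \<bullet> (z - a)"
definition cy :: "real^2 \<Rightarrow> real" where "cy z = d2 \<bullet> (z - a)"

definition tri :: "(real^2) set" where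
  "tri = {z. 0 \<le> cx z \<and> 0 \<le> cy z \<and> cx z + cy z \<le> 1}"

definition pt :: "real \<Rightarrow> real \<Rightarrow> real \<Rightarrow> real^2" where
  "pt n s t = a + (s / n) *\<^sub>R e1 + (t / n) *\<^sub>R e2"

text \<open>The chain rule applied to the hat function of node \<open>(i, j)\<close>, as
  \<open>d1\<close> and \<open>d2\<close> are the gradients of the coordinates. It is defined on the
  whole plane, so that oddness about the node holds at every point.\<close>

definition hat_grad :: "real \<Rightarrow> int \<Rightarrow> int \<Rightarrow> real^2 \<Rightarrow> real^2" where
  "hat_grad n i j z = n *\<^sub>R (hat_slope (n * cx z - i) (n * cy z - j) *\<^sub>R d1
     + hat_slope (n * cy z - j) (n * cx z - i) *\<^sub>R d2)"

definition hat_inner :: "real \<Rightarrow> int \<Rightarrow> int \<Rightarrow> real \<Rightarrow> int \<Rightarrow> int \<Rightarrow> real" where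
  "hat_inner n i j m i' j' = (LINT z|lborel. indicator tri z * (hat_grad n i j z \<bullet> hat_grad m i' j' z))"

lemma cx_pt [simp]: "cx (pt n s t) = s / n" and cy_pt [simp]: "cy (pt n s t) = t / n"
  by (simp_all add: cx_def cy_def pt_def inner_add_right inner_diff_right dual)

lemma eq_frame: "z = a + cx z *\<^sub>R e1 + cy z *\<^sub>R e2"
  using expand[of "z - a"] by (simp add: cx_def cy_def algebra_simps)

lemma cx_diff: "cx z - cx q = d1 \<bullet> (z - q)" and cy_diff: "cy z - cy q = d2 \<bullet> (z - q)"
  by (simp_all add: cx_def cy_def inner_diff_right)

lemma continuous_cx [continuous_intros]: "continuous_on S cx"
  and continuous_cy [continuous_intros]: "continuous_on S cy"
  unfolding cx_def cy_def by (intro continuous_intros)+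

lemma cx_measurable [measurable]: "cx \<in> borel_measurable borel"
  and cy_measurable [measurable]: "cy \<in> borel_measurable borel"
  by (intro borel_measurable_continuous_onI continuous_intros)+

lemma closed_tri: "closed tri"
  unfolding tri_def by (intro closed_Collect_conj closed_Collect_le continuous_intros)

lemma tri_measurable [measurable]: "tri \<in> sets borel"
  using closed_tri by simp

section \<open>Size, support and decay of hat gradients\<close>

lemma hat_grad_measurable [measurable]: "hat_grad n i j \<in> borel_measurable borel"
  unfolding hat_grad_def by measurable

lemma norm_hat_grad_le: "0 \<le> n \<Longrightarrow> norm (hat_grad n i j z) \<le> n * (norm d1 + norm d2)"
  unfolding hat_grad_def norm_scaleR
  by (auto intro!: mult_left_mono order.trans[OF norm_triangle_ineq] add_mono
      mult_left_le_one_le abs_hat_slope_le)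

lemma hat_grad_nonzeroD:
  assumes "hat_grad n i j z \<noteq> 0"
  shows "\<bar>n * cx z - i\<bar> < 1" "\<bar>n * cy z - j\<bar> < 1"
proof -
  have "\<bar>n * cx z - i\<bar> < 1 \<and> \<bar>n * cy z - j\<bar> < 1"
    using assms hat_slope_eq_0[of "n * cx z - i" "n * cy z - j"]
      hat_slope_eq_0[of "n * cy z - j" "n * cx z - i"]
    unfolding hat_grad_def by fastforce
  then show "\<bar>n * cx z - i\<bar> < 1" "\<bar>n * cy z - j\<bar> < 1" by auto
qed

lemma hat_grad_supp:
  assumes "0 < n" "hat_grad n i j z \<noteq> 0"
  shows "z \<in> cbox (pt n i j - vec ((norm e1 + norm e2) / n)) (pt n i j + vec ((norm e1 + norm e2) / n))"
proof -
  let ?q = "pt n i j"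
  have "\<bar>cx z - cx ?q\<bar> \<le> 1 / n" "\<bar>cy z - cy ?q\<bar> \<le> 1 / n"
    using hat_grad_nonzeroD[OF assms(2)] assms(1) by (auto simp: field_simps abs_le_iff abs_less_iff)
  then have le: "\<bar>d1 \<bullet> (z - ?q)\<bar> \<le> 1 / n" "\<bar>d2 \<bullet> (z - ?q)\<bar> \<le> 1 / n"
    by (simp_all only: cx_diff cy_diff)
  have "norm (z - ?q) = norm ((d1 \<bullet> (z - ?q)) *\<^sub>R e1 + (d2 \<bullet> (z - ?q)) *\<^sub>R e2)"
    by (rule arg_cong[OF expand])
  also have "\<dots> \<le> \<bar>d1 \<bullet> (z - ?q)\<bar> * norm e1 + \<bar>d2 \<bullet> (z - ?q)\<bar> * norm e2"
    unfolding norm_scaleR[symmetric] by (rule norm_triangle_ineq)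
  also have "\<dots> \<le> 1 / n * norm e1 + 1 / n * norm e2"
    using le by (intro add_mono mult_right_mono) auto
  finally have "norm (z - ?q) \<le> (norm e1 + norm e2) / n" by (simp add: add_divide_distrib)
  then have "\<bar>(z - ?q) $ i\<bar> \<le> (norm e1 + norm e2) / n" for i
    using component_le_norm_cart[of "z - ?q" i] by linarith
  then show ?thesis
    by (auto simp: mem_box_cart abs_le_iff algebra_simps)
qed

lemma hat_inner_integrand_le:
  assumes "0 < n" "0 < m"
  shows "\<bar>indicator tri z * (hat_grad n i j z \<bullet> hat_grad m i' j' z)\<bar>
    \<le> n * m * (norm d1 + norm d2)\<^sup>2 *
      indicator (cbox (pt m i' j' - vec ((norm e1 + norm e2) / m)) (pt m i' j' + vec ((norm e1 + norm e2) / m))) z"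
proof (cases "hat_grad m i' j' z = 0")
  case False
  have "\<bar>hat_grad n i j z \<bullet> hat_grad m i' j' z\<bar> \<le> norm (hat_grad n i j z) * norm (hat_grad m i' j' z)"
    by (rule Cauchy_Schwarz_ineq2)
  also have "\<dots> \<le> (n * (norm d1 + norm d2)) * (m * (norm d1 + norm d2))"
    using assms by (intro mult_mono norm_hat_grad_le) auto
  finally show ?thesis
    using hat_grad_supp[OF assms(2) False]
    by (auto simp: indicator_def power2_eq_square mult_ac)
qed (use assms in \<open>auto simp: indicator_def\<close>)

lemma integrable_hat_inner:
  assumes "0 < n" "0 < m"
  shows "integrable lborel (\<lambda>z. indicator tri z * (hat_grad n i j z \<bullet> hat_grad m i' j' z))"
proof (rule Bochner_Integration.integrable_bound)
  show "AE z in lborel. norm (indicator tri z * (hat_grad n i j z \<bullet> hat_grad m i' j' z))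
    \<le> norm (n * m * (norm d1 + norm d2)\<^sup>2 *
      indicator (cbox (pt m i' j' - vec ((norm e1 + norm e2) / m)) (pt m i' j' + vec ((norm e1 + norm e2) / m))) z)"
    unfolding real_norm_def
    by (intro AE_I2 order.trans[OF hat_inner_integrand_le[OF assms] abs_ge_self])
qed (rule integrable_cube, measurable)

text \<open>The gradients contribute a factor of order \<open>n * m\<close>, and the support of the
  second one lies in a square of area of order \<open>1 / m^2\<close>. Localising with the finer of
  the two patches produces the decay.\<close>

lemma abs_hat_inner_le:
  assumes "0 < n" "0 < m"
  shows "\<bar>hat_inner n i j m i' j'\<bar> \<le> 4 * (norm d1 + norm d2)\<^sup>2 * (norm e1 + norm e2)\<^sup>2 * (n / m)"
proof -
  let ?r = "(norm e1 + norm e2) / m"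
  let ?Q = "cbox (pt m i' j' - vec ?r) (pt m i' j' + vec ?r)"
  have "\<bar>hat_inner n i j m i' j'\<bar> \<le> (LINT z|lborel. \<bar>indicator tri z * (hat_grad n i j z \<bullet> hat_grad m i' j' z)\<bar>)"
    unfolding hat_inner_def by (rule integral_abs_bound)
  also have "\<dots> \<le> (LINT z|lborel. n * m * (norm d1 + norm d2)\<^sup>2 * indicator ?Q z)"
    using integrable_hat_inner[OF assms] hat_inner_integrand_le[OF assms]
    by (intro integral_mono integrable_cube) simp_all
  also have "\<dots> = n * m * (norm d1 + norm d2)\<^sup>2 * (2 * ?r)\<^sup>2"
    using assms by (subst integral_mult_right_zero) (simp add: measure_lborel_cube del: vec_scaleR)
  also have "\<dots> = 4 * (norm d1 + norm d2)\<^sup>2 * (norm e1 + norm e2)\<^sup>2 * (n / m)"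
    using assms by (simp add: field_simps power2_eq_square)
  finally show ?thesis .
qed

text \<open>At a common point of both supports, the coarse estimate is scaled by \<open>r\<close> to
  fine lattice units and combined with the fine one.\<close>

lemma hat_inner_eq_0_far:
  assumes "0 < n" "0 < r"
    and "hat_inner n i j (n * r) i' j' \<noteq> 0"
  shows "\<bar>i' - r * i\<bar> < 1 + r" "\<bar>j' - r * j\<bar> < 1 + r"
proof -
  have "\<exists>z. hat_grad n i j z \<bullet> hat_grad (n * r) i' j' z \<noteq> 0"
    using assms(3) by (rule contrapos_np) (simp add: hat_inner_def)
  then obtain z where "hat_grad n i j z \<noteq> 0" "hat_grad (n * r) i' j' z \<noteq> 0"
    by (metis inner_zero_left inner_zero_right)
  note h = hat_grad_nonzeroD[OF this(1)] hat_grad_nonzeroD[OF this(2)]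
  have "\<bar>r * (n * cx z) - r * i\<bar> < r" "\<bar>r * (n * cy z) - r * j\<bar> < r"
    using h(1,2) \<open>0 < r\<close> by (simp_all add: abs_mult flip: right_diff_distrib)
  with h(3,4) show "\<bar>i' - r * i\<bar> < 1 + r" "\<bar>j' - r * j\<bar> < 1 + r"
    by (auto simp: mult_ac abs_less_iff)
qed

text \<open>The integers \<open>k\<close> and \<open>c\<close> are at distance at least 1, so moving
  from \<open>k\<close> to \<open>t\<close> cannot cross \<open>c\<close>.\<close>

lemma sgn_diff_near_int:
  fixes t :: real and k c :: int
  assumes "\<bar>t - k\<bar> < 1" "k \<noteq> c"
  shows "sgn (t - c) = sgn (real_of_int (k - c))" "t < c \<longleftrightarrow> k < c" "c < t \<longleftrightarrow> c < k"
  using assms by (auto simp: sgn_if abs_less_iff; linarith)+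

text \<open>If the fine node lies off the coarse grid lines, its patch lies inside one coarse cell. There
  the coarse gradient is constant, and the fine gradient is odd about the node.\<close>

lemma hat_slope_const_off_grid:
  fixes s t :: real and i j i' j' r :: int
  assumes "0 < r" and off: "\<not> r dvd i'" "\<not> r dvd j'" "\<not> r dvd i' + j'"
    and s: "\<bar>s - i'\<bar> < 1" and t: "\<bar>t - j'\<bar> < 1" and st: "\<bar>s + t - (i' + j')\<bar> < 1"
  shows "hat_slope (s / r - i) (t / r - j) = hat_slope (i' / r - i) (j' / r - j)"
proof -
  have r: "(0::real) < r" using assms(1) by simp
  have ne: "i' \<noteq> r * k" "j' \<noteq> r * k" "i' + j' \<noteq> r * k" for k
    using off by auto
  have st': "\<bar>s + t - real_of_int (i' + j')\<bar> < 1" using st by simp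
  \<comment> \<open>Comparing \<open>u / r\<close> with \<open>k\<close> is comparing
    \<open>u\<close> with \<open>r * k\<close>. No such multiple is a coordinate of the fine node,
    or their sum, so every comparison in \<open>hat_slope\<close> has the same outcome at the point
    and at the node.\<close>
  have sc: "sgn (u / r - k) = sgn (u - real_of_int (r * k))"
      "u / r < k \<longleftrightarrow> u < real_of_int (r * k)" "k < u / r \<longleftrightarrow> real_of_int (r * k) < u" for u :: real and k :: int
  proof -
    have "u / r - k = (1 / r) * (u - real_of_int (r * k))" using r by (simp add: field_simps)
    then show "sgn (u / r - k) = sgn (u - real_of_int (r * k))"
      using r by (simp only: sgn_mult) simp
  qed (use r in \<open>simp_all add: field_simps\<close>)
  have abs1: "\<bar>u / r - k\<bar> < 1 \<longleftrightarrow> real_of_int (k - 1) < u / r \<and> u / r < real_of_int (k + 1)"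
    for u :: real and k :: int by (auto simp: abs_less_iff)
  have sum: "s / r - i + (t / r - j) = (s + t) / r - real_of_int (i + j)"
      "i' / r - i + (j' / r - j) = real_of_int (i' + j') / r - real_of_int (i + j)"
    by (simp_all add: add_divide_distrib)
  show ?thesis
    unfolding hat_slope_def sum abs1 sc
      sgn_diff_near_int[OF s ne(1)] sgn_diff_near_int[OF t ne(2)] sgn_diff_near_int[OF st' ne(3)]
      of_int_diff[symmetric] of_int_less_iff
    by (rule refl)
qed

lemma hat_inner_eq_0_off_grid:
  fixes n r :: nat and i j i' j' :: int
  assumes "0 < n" "0 < r"
    and node: "0 \<le> i'" "0 \<le> j'" "i' + j' \<le> int (n * r)"
    and off: "\<not> int r dvd i'" "\<not> int r dvd j'" "\<not> int r dvd i' + j'"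
  shows "hat_inner n i j (real n * r) i' j' = 0"
proof -
  let ?m = "real n * r"
  let ?q = "pt ?m i' j'"
  have m: "0 < ?m" using assms by simp
  \<comment> \<open>On the fine patch the coarse gradient may be frozen at the node and the
    indicator dropped; off the patch both sides are 0. The right-hand side is odd about the
    node.\<close>
  have eq: "indicator tri z * (hat_grad n i j z \<bullet> hat_grad ?m i' j' z)
      = hat_grad n i j ?q \<bullet> hat_grad ?m i' j' z" for z
  proof (cases "hat_grad ?m i' j' z = 0")
    case False
    let ?s = "?m * cx z" and ?t = "?m * cy z"
    have "\<not> (hat_slope (?s - i') (?t - j') = 0 \<and> hat_slope (?t - j') (?s - i') = 0)"
      using False by (auto simp: hat_grad_def)
    then have near: "\<bar>?s - i'\<bar> < 1" "\<bar>?t - j'\<bar> < 1" "\<bar>?s + ?t - (i' + j')\<bar> < 1"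
      by (auto simp: hat_slope_def algebra_simps split: if_splits)
    have near': "\<bar>?t + ?s - (j' + i')\<bar> < 1" using near(3) by (simp add: add.commute)
    have r: "0 < int r" using assms by simp
    have n_eq: "n * cx z = ?s / int r" "n * cy z = ?t / int r"
        "n * cx ?q = i' / int r" "n * cy ?q = j' / int r"
      using assms by simp_all
    have "hat_grad n i j z = hat_grad n i j ?q"
      unfolding hat_grad_def n_eq
      using hat_slope_const_off_grid[OF r off(1,2,3) near]
        hat_slope_const_off_grid[OF r off(2,1) _ near(2,1) near'] off(3)
      by (simp add: add.commute)
    \<comment> \<open>On a side of the triangle one of \<open>i'\<close>, \<open>j'\<close>,
      \<open>i' + j'\<close> would be 0 or \<open>n * r\<close>, a multiple of \<open>r\<close>. The
      node is thus at least one fine step away from each side, and its patch stays inside.\<close>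
    moreover have "z \<in> tri"
    proof -
      have "i' \<noteq> 0" "j' \<noteq> 0" "i' + j' \<noteq> int (n * r)" using off by auto
      then have "1 \<le> i'" "1 \<le> j'" "i' + j' + 1 \<le> int (n * r)" using node by auto
      then have "1 \<le> real_of_int i'" "1 \<le> real_of_int j'"
        and "real_of_int (i' + j' + 1) \<le> real_of_int (int (n * r))"
        by (simp_all only: of_int_le_iff of_int_1_le_iff)
      then have "0 \<le> ?s" "0 \<le> ?t" "?s + ?t \<le> ?m"
        using near by (auto simp: abs_less_iff)
      then have "0 \<le> cx z" "0 \<le> cy z" "?m * (cx z + cy z) \<le> ?m * 1"
        using m by (auto simp: zero_le_mult_iff distrib_left)
      then show ?thesis unfolding mult_le_cancel_left_pos[OF m] by (simp add: tri_def)
    qed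
    ultimately show ?thesis by simp
  qed simp
  have "hat_grad ?m i' j' (2 *\<^sub>R ?q - z) = - hat_grad ?m i' j' z" for z
  proof -
    have "?m * cx (2 *\<^sub>R ?q - z) - i' = - (?m * cx z - i')"
      "?m * cy (2 *\<^sub>R ?q - z) - j' = - (?m * cy z - j')"
    proof -
      have "cx (2 *\<^sub>R ?q - z) = 2 * cx ?q - cx z" "cy (2 *\<^sub>R ?q - z) = 2 * cy ?q - cy z"
        by (simp_all add: cx_def cy_def inner_diff_right algebra_simps)
      then show "?m * cx (2 *\<^sub>R ?q - z) - i' = - (?m * cx z - i')"
        "?m * cy (2 *\<^sub>R ?q - z) - j' = - (?m * cy z - j')"
        using assms(1,2) by (simp_all add: right_diff_distrib)
    qed
    then show ?thesis unfolding hat_grad_def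
      by (simp only: hat_slope_minus scaleR_minus_left minus_add_distrib[symmetric] scaleR_minus_right)
  qed
  then show ?thesis
    unfolding hat_inner_def eq by (intro integral_lborel_odd[where q = ?q]) auto
qed

text \<open>Even for a node on the boundary, one full cell of the patch lies in the triangle. There
  the squared gradient is at least \<open>g * n^2\<close>, and an inscribed square has area
  proportional to \<open>1 / n^2\<close>, so the powers of \<open>n\<close> cancel.\<close>

lemma hat_inner_self_lower:
  "\<exists>c>0. \<forall>n i j. 0 < n \<longrightarrow> 0 \<le> i \<longrightarrow> 0 \<le> j \<longrightarrow> i + j \<le> int n \<longrightarrow> c \<le> hat_inner (real n) i j (real n) i j"
proof -
  define D where "D = norm d1 + norm d2"
  define g where "g = Min {(norm (d1 + d2))\<^sup>2, (norm d1)\<^sup>2, (norm d2)\<^sup>2}"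
  have "d1 \<noteq> 0" "d2 \<noteq> 0" using dual by auto
  have "d1 + d2 \<noteq> 0"
  proof
    assume "d1 + d2 = 0"
    then have "(d1 + d2) \<bullet> e1 = 0" by simp
    then show False using dual by (simp add: inner_add_left)
  qed
  then have "0 < g" "0 < D" using \<open>d1 \<noteq> 0\<close> \<open>d2 \<noteq> 0\<close> by (auto simp: g_def D_def add_pos_pos)
  have "4 * g / (169 * D\<^sup>2) \<le> hat_inner (real n) i j (real n) i j"
    if n: "0 < n" and ij: "0 \<le> i" "0 \<le> j" "i + j \<le> int n" for n i j
  proof -
    let ?n = "real n"
    \<comment> \<open>The factor 13 yields \<open>n * (D * (2 * r)) = 2/13 < 1/6\<close>. The value
      1/6 is a tolerance around the centroid of the chosen cell within which its defining strict
      inequalities persist.\<close>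
    define r where "r = 1 / (13 * ?n * D)"
    have "0 < r" using n \<open>0 < D\<close> by (simp add: r_def)
    have "1 \<le> ?n" using n by simp
    have ij': "0 \<le> real_of_int i" "0 \<le> real_of_int j" "real_of_int i + real_of_int j \<le> ?n"
      using ij by (simp_all flip: of_int_add)
    have "\<exists>(u::real) (v::real). \<forall>z. \<bar>?n * cx z - (i + u)\<bar> < 1 / 6 \<longrightarrow> \<bar>?n * cy z - (j + v)\<bar> < 1 / 6 \<longrightarrow>
        z \<in> tri \<and> g * ?n\<^sup>2 \<le> (norm (hat_grad ?n i j z))\<^sup>2"
    proof -
      have in_tri: "z \<in> tri" if "0 \<le> ?n * cx z" "0 \<le> ?n * cy z" "?n * cx z + ?n * cy z \<le> ?n" for z
        using that n by (auto simp: tri_def zero_le_mult_iff simp flip: distrib_left)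
      have g: "g \<le> (norm (d1 + d2))\<^sup>2" "g \<le> (norm d1)\<^sup>2" "g \<le> (norm d2)\<^sup>2"
        by (simp_all add: g_def)
      \<comment> \<open>On the hypotenuse the corner cell leaves the triangle. As
        \<open>n > 0\<close>, one coordinate of the node is positive, and the cell to the left or
        below is used. The offsets (1/3, 1/3), (-2/3, 1/3) and (1/3, -2/3) are the centroids of the
        three cells.\<close>
      consider "i + j < int n" | "i + j = int n" "1 \<le> i" | "i + j = int n" "1 \<le> j"
        using ij n by linarith
      then show ?thesis
      proof cases
        case 1
        then have "i + j + 1 \<le> int n" by simp
        then have "real_of_int (i + j + 1) \<le> real_of_int (int n)" by (simp only: of_int_le_iff)
        then have 1: "real_of_int i + real_of_int j + 1 \<le> ?n" by simp
        show ?thesis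
        proof (intro exI[of _ "1/3"] allI impI conjI)
          fix z assume z: "\<bar>?n * cx z - (i + 1/3)\<bar> < 1 / 6" "\<bar>?n * cy z - (j + 1/3)\<bar> < 1 / 6"
          show "z \<in> tri" by (rule in_tri) (use z[unfolded abs_less_iff] 1 ij' in linarith)+
          have "hat_grad ?n i j z = - ?n *\<^sub>R (d1 + d2)"
            using z[unfolded abs_less_iff]
            by (simp add: hat_grad_def hat_slope_corner hat_slope_left hat_slope_below scaleR_add_right scaleR_right_diff_distrib)
          then show "g * ?n\<^sup>2 \<le> (norm (hat_grad ?n i j z))\<^sup>2"
            using g by (simp add: power_mult_distrib mult.commute[of g] mult_left_mono)
        qed
      next
        case 2
        then have 2: "real_of_int i + real_of_int j = ?n" "1 \<le> real_of_int i"
          by (simp_all flip: of_int_add)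
        show ?thesis
        proof (rule exI[of _ "-2/3"], rule exI[of _ "1/3"], intro allI impI conjI)
          fix z assume z: "\<bar>?n * cx z - (i + -2/3)\<bar> < 1 / 6" "\<bar>?n * cy z - (j + 1/3)\<bar> < 1 / 6"
          show "z \<in> tri" by (rule in_tri) (use z[unfolded abs_less_iff] 2 ij' in linarith)+
          have "hat_grad ?n i j z = ?n *\<^sub>R d1"
            using z[unfolded abs_less_iff]
            by (simp add: hat_grad_def hat_slope_corner hat_slope_left hat_slope_below scaleR_add_right scaleR_right_diff_distrib)
          then show "g * ?n\<^sup>2 \<le> (norm (hat_grad ?n i j z))\<^sup>2"
            using g by (simp add: power_mult_distrib mult.commute[of g] mult_left_mono)
        qed
      next
        case 3
        then have 3: "real_of_int i + real_of_int j = ?n" "1 \<le> real_of_int j"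
          by (simp_all flip: of_int_add)
        show ?thesis
        proof (rule exI[of _ "1/3"], rule exI[of _ "-2/3"], intro allI impI conjI)
          fix z assume z: "\<bar>?n * cx z - (i + 1/3)\<bar> < 1 / 6" "\<bar>?n * cy z - (j + -2/3)\<bar> < 1 / 6"
          show "z \<in> tri" by (rule in_tri) (use z[unfolded abs_less_iff] 3 ij' in linarith)+
          have "hat_grad ?n i j z = ?n *\<^sub>R d2"
            using z[unfolded abs_less_iff]
            by (simp add: hat_grad_def hat_slope_corner hat_slope_left hat_slope_below scaleR_add_right scaleR_right_diff_distrib)
          then show "g * ?n\<^sup>2 \<le> (norm (hat_grad ?n i j z))\<^sup>2"
            using g by (simp add: power_mult_distrib mult.commute[of g] mult_left_mono)
        qed
      qed
    qed
    then obtain u v :: real where uv: "\<And>z. \<bar>?n * cx z - (i + u)\<bar> < 1 / 6 \<Longrightarrow> \<bar>?n * cy z - (j + v)\<bar> < 1 / 6 \<Longrightarrow>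
        z \<in> tri \<and> g * ?n\<^sup>2 \<le> (norm (hat_grad ?n i j z))\<^sup>2" by blast
    define q where "q = pt ?n (i + u) (j + v)"
    let ?Q = "cbox (q - vec r) (q + vec r)"
    have Q: "z \<in> tri \<and> g * ?n\<^sup>2 \<le> (norm (hat_grad ?n i j z))\<^sup>2" if "z \<in> ?Q" for z
    proof (rule uv)
      have "\<bar>(z - q) $ k\<bar> \<le> r" for k
        using that by (auto simp: mem_box_cart abs_le_iff algebra_simps)
      then have "norm (z - q) \<le> 2 * r"
        using norm_le_l1_cart[of "z - q"] sum_mono[of UNIV "\<lambda>k. \<bar>(z - q) $ k\<bar>" "\<lambda>k. r"]
        by (simp add: UNIV_2)
      then have *: "\<bar>d \<bullet> (z - q)\<bar> \<le> D * (2 * r)" if "norm d \<le> D" for d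
        using that by (intro order.trans[OF Cauchy_Schwarz_ineq2] mult_mono) (auto simp: \<open>0 < D\<close> less_imp_le)
      have nD: "?n * (D * (2 * r)) < 1 / 6" using n \<open>0 < D\<close> by (simp add: r_def)
      have "?n * cx z - (i + u) = ?n * (d1 \<bullet> (z - q))" "?n * cy z - (j + v) = ?n * (d2 \<bullet> (z - q))"
        using n by (simp_all add: q_def right_diff_distrib flip: cx_diff cy_diff)
      moreover have "?n * \<bar>d1 \<bullet> (z - q)\<bar> \<le> ?n * (D * (2 * r))" "?n * \<bar>d2 \<bullet> (z - q)\<bar> \<le> ?n * (D * (2 * r))"
        by (intro mult_left_mono *; simp add: D_def)+
      ultimately show "\<bar>?n * cx z - (i + u)\<bar> < 1 / 6" "\<bar>?n * cy z - (j + v)\<bar> < 1 / 6"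
        using nD by (simp_all add: abs_mult)
    qed
    have "4 * g / (169 * D\<^sup>2) = g * ?n\<^sup>2 * (2 * r)\<^sup>2"
      using n \<open>0 < D\<close> by (simp add: r_def field_simps power2_eq_square)
    also have "\<dots> = (LINT z|lborel. g * ?n\<^sup>2 * indicator ?Q z)"
      using \<open>0 < r\<close> by (subst integral_mult_right_zero) (simp add: measure_lborel_cube)
    also have "\<dots> \<le> hat_inner ?n i j ?n i j"
      unfolding hat_inner_def
    proof (rule integral_mono)
      show "integrable lborel (\<lambda>z. g * ?n\<^sup>2 * indicat_real ?Q z)"
        by (rule integrable_cube)
      show "integrable lborel (\<lambda>z. indicator tri z * (hat_grad ?n i j z \<bullet> hat_grad ?n i j z))"
        using n by (intro integrable_hat_inner) auto
      show "g * ?n\<^sup>2 * indicat_real ?Q z \<le> indicator tri z * (hat_grad ?n i j z \<bullet> hat_grad ?n i j z)" for z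
        using Q[of z] by (auto simp: indicator_def dot_square_norm)
    qed
    finally show ?thesis .
  qed
  moreover have "0 < 4 * g / (169 * D\<^sup>2)" using \<open>0 < g\<close> \<open>0 < D\<close> by simp
  ultimately show ?thesis by blast
qed

end

subsection \<open>Subdivisions of a triangle\<close>

text \<open>A half-plane containing \<open>y\<close> and \<open>z\<close>, hence their segment, but
  not \<open>x\<close>. The test lets the coordinate functionals identify the vertices of mesh
  cells.\<close>

lemma extreme_point_of_triangle:
  fixes d x y z :: "'a::euclidean_space"
  assumes "d \<bullet> y \<le> c" "d \<bullet> z \<le> c" "c < d \<bullet> x"
  shows "x extreme_point_of (convex hull {x, y, z})"
proof (rule extreme_point_of_convex_hull_insert)
  have "convex hull {y, z} \<subseteq> {p. d \<bullet> p \<le> c}"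
    using assms by (intro hull_minimal convex_halfspace_le) auto
  then show "x \<notin> convex hull {y, z}" using assms by auto
qed simp

lemma grad_eqI:
  assumes "(w has_derivative (\<lambda>h. g \<bullet> h)) (at z)"
  shows "grad w z = g"
  unfolding grad_def frechet_derivative_at[OF assms, symmetric]
  by (simp add: vec_eq_iff inner_axis)

text \<open>The right-hand side is the value at \<open>(i + 1, j)\<close> minus the value at
  \<open>(i, j)\<close> of the hat centred at the origin, which is the slope of the linear
  interpolant along the first edge.\<close>

lemma hat_slope_unit_cell:
  fixes i j :: int and u v :: real
  assumes "0 < u" "0 < v" "u + v < 1"
  shows "hat_slope (i + u) (j + v) = of_bool (i = - 1 \<and> j = 0) - of_bool (i = 0 \<and> j = 0)"
proof -
  consider "i = 0" "j = 0" | "i = -1" "j = 0" | "i = 0" "j = -1"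
    | "i \<noteq> 0" "i \<noteq> -1" | "j \<noteq> 0" "j \<noteq> -1" | "i = -1" "j = -1" by blast
  then show ?thesis
  proof cases
    case 4
    then have "i \<ge> 1 \<or> i \<le> -2" by linarith
    then have "real_of_int i \<ge> 1 \<or> real_of_int i \<le> -2" by linarith
    then have "\<not> \<bar>i + u\<bar> < 1" using assms by linarith
    then show ?thesis using 4 by (simp add: hat_slope_def)
  next
    case 5
    then have "j \<ge> 1 \<or> j \<le> -2" by linarith
    then have "real_of_int j \<ge> 1 \<or> real_of_int j \<le> -2" by linarith
    then have "\<not> \<bar>j + v\<bar> < 1" using assms by linarith
    then show ?thesis using 5 by (simp add: hat_slope_def)
  qed (use assms in \<open>auto simp: hat_slope_def sgn_if abs_if\<close>)
qed

text \<open>Oddness reduces reflected cells to unreflected ones. The result has the shape of the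
  difference quotient in \<open>piecewise_affine_has_derivative\<close>, for either
  orientation.\<close>

lemma hat_slope_cell:
  fixes i j i0 j0 e :: int and u v :: real
  assumes e: "e = 1 \<or> e = -1" and uv: "0 < u" "0 < v" "u + v < 1"
  shows "hat_slope (i + e * u - i0) (j + e * v - j0)
    = real_of_int e * (of_bool (i + e = i0 \<and> j = j0) - of_bool (i = i0 \<and> j = j0))"
  using e
proof
  assume "e = 1"
  then show ?thesis
    using hat_slope_unit_cell[OF uv, of "i - i0" "j - j0"] by (auto simp: algebra_simps)
next
  assume "e = -1"
  have "hat_slope (i - u - i0) (j - v - j0) = hat_slope (- (real_of_int (i0 - i) + u)) (- (real_of_int (j0 - j) + v))"
    by (simp add: algebra_simps)
  then show ?thesis
    unfolding hat_slope_minus using hat_slope_unit_cell[OF uv, of "i0 - i" "j0 - j"] \<open>e = -1\<close>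
    by auto
qed

context triangle_frame
begin

lemma frame_eqI: "cx z = cx z' \<Longrightarrow> cy z = cy z' \<Longrightarrow> z = z'"
  by (metis eq_frame)

lemma tri_eq_hull: "tri = convex hull {a, a + e1, a + e2}"
proof
  show "convex hull {a, a + e1, a + e2} \<subseteq> tri"
  proof (rule hull_minimal)
    have "tri = {z. (- d1) \<bullet> z \<le> - (d1 \<bullet> a)} \<inter> {z. (- d2) \<bullet> z \<le> - (d2 \<bullet> a)}
        \<inter> {z. (d1 + d2) \<bullet> z \<le> 1 + (d1 + d2) \<bullet> a}"
      by (auto simp: tri_def cx_def cy_def inner_diff_right inner_add_left)
    then show "convex tri" by (simp only:) (intro convex_Int convex_halfspace_le)
  qed (auto simp: tri_def cx_def cy_def dual)
  show "tri \<subseteq> convex hull {a, a + e1, a + e2}"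
  proof
    fix z assume "z \<in> tri"
    then have "z = (1 - cx z - cy z) *\<^sub>R a + cx z *\<^sub>R (a + e1) + cy z *\<^sub>R (a + e2)"
        "0 \<le> cx z" "0 \<le> cy z" "0 \<le> 1 - cx z - cy z"
      using eq_frame[of z] by (auto simp: tri_def algebra_simps)
    then show "z \<in> convex hull {a, a + e1, a + e2}"
      unfolding convex_hull_3 by fastforce
  qed
qed

text \<open>The cells of the \<open>n\<close>-fold subdivision: \<open>e = 1\<close> gives the translated and scaled copies of the
  triangle, \<open>e = -1\<close> the reflected ones, and \<open>admissible\<close> says that the cell lies in the triangle.\<close>

definition cell :: "real \<Rightarrow> int \<Rightarrow> int \<Rightarrow> int \<Rightarrow> (real^2) set" where
  "cell n e i j = convex hull {pt n i j, pt n (i + e) j, pt n i (j + e)}"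

definition admissible :: "nat \<Rightarrow> int \<Rightarrow> int \<Rightarrow> int \<Rightarrow> bool" where
  "admissible n e i j \<longleftrightarrow>
     e = 1 \<and> 0 \<le> i \<and> 0 \<le> j \<and> i + j + 1 \<le> int n \<or> e = - 1 \<and> 1 \<le> i \<and> 1 \<le> j \<and> i + j \<le> int n"

definition lattice :: "nat \<Rightarrow> int \<Rightarrow> int \<Rightarrow> bool" where
  "lattice n i j \<longleftrightarrow> 0 \<le> i \<and> 0 \<le> j \<and> i + j \<le> int n"

section \<open>Cells and nodes of the refined meshes\<close>

lemma admissible_lattice:
  "admissible n e i j \<Longrightarrow> lattice n i j \<and> lattice n (i + e) j \<and> lattice n i (j + e)"
  by (auto simp: admissible_def lattice_def)

lemma midpoint_pt: "midpoint (pt n s t) (pt n s' t') = pt (2 * n) (s + s') (t + t')"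
  by (simp add: midpoint_def pt_def algebra_simps add_divide_distrib)
     (simp add: vec_eq_iff algebra_simps)

lemma pt_double: "pt n s t = pt (2 * n) (2 * s) (2 * t)"
  by (simp add: pt_def)

lemma corner_subtriangles:
  "K = convex hull {p, q, r} \<Longrightarrow> convex hull {p, midpoint p q, midpoint p r} \<in> subtriangles K"
  unfolding subtriangles_def by blast

lemma middle_subtriangles:
  "K = convex hull {p, q, r} \<Longrightarrow> convex hull {midpoint p q, midpoint q r, midpoint r p} \<in> subtriangles K"
  unfolding subtriangles_def by blast

lemma cell_subtriangles:
  "cell (2 * n) e (2 * i) (2 * j) \<in> subtriangles (cell n e i j)"
  "cell (2 * n) e (2 * i + e) (2 * j) \<in> subtriangles (cell n e i j)"
  "cell (2 * n) e (2 * i) (2 * j + e) \<in> subtriangles (cell n e i j)"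
  "cell (2 * n) (- e) (2 * i + e) (2 * j + e) \<in> subtriangles (cell n e i j)"
proof -
  let ?p = "pt n i j" and ?q = "pt n (i + e) j" and ?r = "pt n i (j + e)"
  \<comment> \<open>The corner clause of \<open>subtriangles\<close> cuts off the vertex listed
    first, so each vertex takes that place once.\<close>
  have K: "cell n e i j = convex hull {?p, ?q, ?r}" "cell n e i j = convex hull {?q, ?p, ?r}"
      "cell n e i j = convex hull {?r, ?p, ?q}"
    by (auto simp: cell_def insert_commute)
  show "cell (2 * n) e (2 * i) (2 * j) \<in> subtriangles (cell n e i j)"
    using corner_subtriangles[OF K(1), unfolded midpoint_pt, unfolded pt_double[of n "i" "j"]]
    unfolding cell_def[of "2 * n"] by (simp add: algebra_simps)
  show "cell (2 * n) e (2 * i + e) (2 * j) \<in> subtriangles (cell n e i j)"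
    using corner_subtriangles[OF K(2), unfolded midpoint_pt, unfolded pt_double[of n "i + e" "j"]]
    unfolding cell_def[of "2 * n"] by (simp add: algebra_simps insert_commute)
  show "cell (2 * n) e (2 * i) (2 * j + e) \<in> subtriangles (cell n e i j)"
    using corner_subtriangles[OF K(3), unfolded midpoint_pt, unfolded pt_double[of n "i" "j + e"]]
    unfolding cell_def[of "2 * n"] by (simp add: algebra_simps insert_commute)
  show "cell (2 * n) (- e) (2 * i + e) (2 * j + e) \<in> subtriangles (cell n e i j)"
    using middle_subtriangles[OF K(1), unfolded midpoint_pt]
    unfolding cell_def[of "2 * n"] by (simp add: algebra_simps insert_commute)
qed

text \<open>The parities of \<open>i\<close> and \<open>j\<close> decide the position in the parent:
  two odd indices mean the middle child of a cell of opposite orientation, all other cases a corner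
  child of a cell of the same orientation.\<close>

lemma admissible_parent:
  assumes "admissible (2 * n) e i j"
  obtains e' i' j' where "admissible n e' i' j'" "cell (2 * real n) e i j \<in> subtriangles (cell n e' i' j')"
proof -
  define I J where "I = i div 2" and "J = j div 2"
  have i: "i = 2 * I \<or> i = 2 * I + 1" and j: "j = 2 * J \<or> j = 2 * J + 1"
    unfolding I_def J_def by presburger+
  have e: "e = 1 \<or> e = - 1" using assms by (auto simp: admissible_def)
  consider "e = 1" "i = 2 * I" "j = 2 * J" | "e = 1" "i = 2 * I + 1" "j = 2 * J"
    | "e = 1" "i = 2 * I" "j = 2 * J + 1" | "e = 1" "i = 2 * I + 1" "j = 2 * J + 1"
    | "e = -1" "i = 2 * I" "j = 2 * J" | "e = -1" "i = 2 * I + 1" "j = 2 * J"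
    | "e = -1" "i = 2 * I" "j = 2 * J + 1" | "e = -1" "i = 2 * I + 1" "j = 2 * J + 1"
    using i j e by blast
  then show thesis
  proof cases
    case 1 then show ?thesis using assms that[of 1 I J] cell_subtriangles(1)[of n 1 I J]
      by (auto simp: admissible_def algebra_simps)
  next
    case 2 then show ?thesis using assms that[of 1 I J] cell_subtriangles(2)[of n 1 I J]
      by (auto simp: admissible_def algebra_simps)
  next
    case 3 then show ?thesis using assms that[of 1 I J] cell_subtriangles(3)[of n 1 I J]
      by (auto simp: admissible_def algebra_simps)
  next
    case 4 then show ?thesis using assms that[of "-1" "I + 1" "J + 1"] cell_subtriangles(4)[of n "-1" "I + 1" "J + 1"]
      by (auto simp: admissible_def algebra_simps)
  next
    case 5 then show ?thesis using assms that[of "-1" I J] cell_subtriangles(1)[of n "-1" I J]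
      by (auto simp: admissible_def algebra_simps)
  next
    case 6 then show ?thesis using assms that[of "-1" "I + 1" J] cell_subtriangles(2)[of n "-1" "I + 1" J]
      by (auto simp: admissible_def algebra_simps)
  next
    case 7 then show ?thesis using assms that[of "-1" I "J + 1"] cell_subtriangles(3)[of n "-1" I "J + 1"]
      by (auto simp: admissible_def algebra_simps)
  next
    case 8 then show ?thesis using assms that[of 1 I J] cell_subtriangles(4)[of n 1 I J]
      by (auto simp: admissible_def algebra_simps)
  qed
qed

text \<open>The induction starts from \<open>tri\<close>, the single cell of the 1-fold subdivision.
  This inclusion suffices later, because affinity on these cells already determines a finite element
  function on \<open>tri\<close>.\<close>

lemma cell_in_mesh:
  assumes "tri \<in> T" "admissible (2 ^ (k - 1)) e i j"
  shows "cell (2 ^ (k - 1)) e i j \<in> mesh T k"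
proof -
  have "cell (2 ^ m) e i j \<in> (refine_mesh ^^ m) T" if "admissible (2 ^ m) e i j" for m
    using that
  proof (induction m arbitrary: e i j)
    case 0
    then have "e = 1" "i = 0" "j = 0" by (auto simp: admissible_def)
    moreover have "cell 1 1 0 0 = tri"
      by (simp add: cell_def tri_eq_hull pt_def)
    ultimately show ?case using assms(1) by simp
  next
    case (Suc m)
    have "admissible (2 * 2 ^ m) e i j" using Suc.prems by simp
    then obtain e' i' j' where "admissible (2 ^ m) e' i' j'"
        "cell (2 * real (2 ^ m)) e i j \<in> subtriangles (cell (real (2 ^ m)) e' i' j')"
      by (rule admissible_parent)
    then show ?case using Suc.IH by (auto simp: refine_mesh_def)
  qed
  then show ?thesis using assms(2) by (simp add: mesh_def)
qed

text \<open>The functionals \<open>- (d1 + d2)\<close>, \<open>d1\<close> and \<open>d2\<close> each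
  single out one vertex of an unreflected cell. A node on the hypotenuse is not the base point of an
  admissible one, so it is reached as the right or upper vertex of a neighbour.\<close>

lemma lattice_mesh_vertex:
  assumes "tri \<in> T" and lat: "lattice (2 ^ (k - 1)) i j"
  shows "pt (2 ^ (k - 1)) i j \<in> mesh_vertices (mesh T k)"
proof -
  let ?n = "2 ^ (k - 1) :: nat"
  let ?m = "2 ^ (k - 1) :: real"
  have m: "0 < ?m" by simp
  have vertices: "pt ?m i j extreme_point_of cell ?m 1 i j"
      "pt ?m (i + 1) j extreme_point_of cell ?m 1 i j"
      "pt ?m i (j + 1) extreme_point_of cell ?m 1 i j" for i j :: int
  proof -
    have d: "d1 \<bullet> pt n s t = d1 \<bullet> a + s / n" "d2 \<bullet> pt n s t = d2 \<bullet> a + t / n" for n s t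
      by (simp_all add: pt_def inner_add_right dual)
    let ?p = "pt ?m i j" and ?q = "pt ?m (i + 1) j" and ?r = "pt ?m i (j + 1)"
    have "?p extreme_point_of (convex hull {?p, ?q, ?r})"
      by (rule extreme_point_of_triangle[of "- (d1 + d2)" _ "- (d1 \<bullet> a + d2 \<bullet> a + (i + j + 1) / ?m)"])
         (simp_all add: d inner_add_left inner_diff_left add_divide_distrib)
    moreover have "?q extreme_point_of (convex hull {?q, ?p, ?r})"
      by (rule extreme_point_of_triangle[of d1 _ "d1 \<bullet> a + i / ?m"]) (simp_all add: d add_divide_distrib)
    moreover have "?r extreme_point_of (convex hull {?r, ?p, ?q})"
      by (rule extreme_point_of_triangle[of d2 _ "d2 \<bullet> a + j / ?m"]) (simp_all add: d add_divide_distrib)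
    ultimately show "?p extreme_point_of cell ?m 1 i j"
      "?q extreme_point_of cell ?m 1 i j" "?r extreme_point_of cell ?m 1 i j"
      by (auto simp: cell_def insert_commute)
  qed
  have n1: "1 \<le> int ?n" by simp
  have "\<exists>i' j'. admissible ?n 1 i' j' \<and> pt ?m i j extreme_point_of cell ?m 1 i' j'"
  proof -
    consider "i + j + 1 \<le> int ?n" | "1 \<le> i" "i + j = int ?n" | "1 \<le> j" "i + j = int ?n"
      using lat n1 unfolding lattice_def by linarith
    then show ?thesis
    proof cases
      case 1 then show ?thesis using vertices(1)[of i j] lat by (auto simp: admissible_def lattice_def)
    next
      case 2 then show ?thesis using vertices(2)[of "i - 1" j] lat
        by (intro exI[of _ "i - 1"] exI[of _ j]) (auto simp: admissible_def lattice_def)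
    next
      case 3 then show ?thesis using vertices(3)[of i "j - 1"] lat
        by (intro exI[of _ i] exI[of _ "j - 1"]) (auto simp: admissible_def lattice_def)
    qed
  qed
  then show ?thesis
    using cell_in_mesh[OF assms(1), of k 1] unfolding mesh_vertices_def by auto
qed

text \<open>Full lines, among them the three sides of the triangle. A point of \<open>tri\<close>
  off the grid is interior to a cell, so its derivative in the plane depends on that cell
  alone.\<close>

definition grid :: "nat \<Rightarrow> (real^2) set" where
  "grid n = {z. n * cx z \<in> \<int> \<or> n * cy z \<in> \<int> \<or> n * cx z + n * cy z \<in> \<int>}"

lemma AE_not_grid:
  assumes "0 < n"
  shows "AE z in lebesgue. z \<notin> grid n"
proof -
  have "d1 \<noteq> 0" "d2 \<noteq> 0" using dual by auto
  have "d1 + d2 \<noteq> 0"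
  proof
    assume "d1 + d2 = 0"
    then have "(d1 + d2) \<bullet> e1 = 0" by simp
    then show False using dual by (simp add: inner_add_left)
  qed
  have *: "AE z in lebesgue. n * (d \<bullet> (z - a)) \<notin> \<int>" if "d \<noteq> 0" for d :: "real^2"
  proof -
    have "AE z in lebesgue. \<forall>c::int. n * (d \<bullet> (z - a)) \<noteq> c"
      unfolding AE_all_countable
    proof
      fix c :: int
      have "{z. n * (d \<bullet> (z - a)) = c} = {z. d \<bullet> z = c / n + d \<bullet> a}"
        using assms by (auto simp: inner_diff_right field_simps)
      then have "{z. n * (d \<bullet> (z - a)) = c} \<in> null_sets lebesgue"
        using negligible_hyperplane[of d "c / n + d \<bullet> a"] that by (simp add: negligible_iff_null_sets)
      then show "AE z in lebesgue. n * (d \<bullet> (z - a)) \<noteq> c"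
        by (rule AE_I') auto
    qed
    then show ?thesis by (auto elim!: Ints_cases elim: eventually_mono)
  qed
  show ?thesis
    using *[OF \<open>d1 \<noteq> 0\<close>] *[OF \<open>d2 \<noteq> 0\<close>] *[OF \<open>d1 + d2 \<noteq> 0\<close>]
    by eventually_elim (auto simp: grid_def cx_def cy_def inner_add_left distrib_left)
qed

text \<open>Integer and fractional parts of the scaled coordinates locate the point. Fractional
  parts with sum above 1 belong to the reflected cell based at the opposite corner
  \<open>(i + 1, j + 1)\<close>. The separate first case is a lattice point on the hypotenuse, where
  rounding down would select a cell outside the triangle.\<close>

lemma tri_cases:
  fixes n :: nat
  assumes "z \<in> tri" "0 < n"
  obtains i j where "lattice n i j" "z = pt n i j" "z \<in> grid n"
  | e i j u v where "admissible n e i j" "0 \<le> (u::real)" "0 \<le> (v::real)" "u + v \<le> 1"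
      "n * cx z = i + e * u" "n * cy z = j + e * v"
      "z \<notin> grid n \<Longrightarrow> 0 < u \<and> 0 < v \<and> u + v < 1"
proof -
  define i j u v where "i = \<lfloor>n * cx z\<rfloor>" and "j = \<lfloor>n * cy z\<rfloor>"
    and "u = frac (n * cx z)" and "v = frac (n * cy z)"
  have xy: "n * cx z = i + u" "n * cy z = j + v"
    by (simp_all add: i_def j_def u_def v_def frac_def)
  have uv: "0 \<le> u" "u < 1" "0 \<le> v" "v < 1"
    by (simp_all add: u_def v_def frac_lt_1)
  have ij: "0 \<le> i" "0 \<le> j" using assms by (simp_all add: i_def j_def tri_def)
  have "n * (cx z + cy z) \<le> n * (1::real)" using assms by (intro mult_left_mono) (auto simp: tri_def)
  then have le: "i + j + (u + v) \<le> real_of_int (int n)" using xy by (simp add: distrib_left)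
  have grid: "z \<in> grid n" if "u = 0 \<or> v = 0 \<or> u + v = 1"
  proof -
    have "n * cx z = real_of_int i \<or> n * cy z = real_of_int j
        \<or> n * cx z + n * cy z = real_of_int (i + j + 1)"
      using that xy by auto
    then show ?thesis unfolding grid_def using Ints_of_int by force
  qed
  have strict: "0 < u \<and> 0 < v \<and> u + v \<noteq> 1" if "z \<notin> grid n"
    using grid uv that by force
  show thesis
  proof (cases "u + v \<le> 1")
    case True
    show thesis
    proof (cases "i + j + 1 \<le> int n")
      case True': True
      show thesis
        by (rule that(2)[of 1 i j u v]) (use True True' ij uv xy strict in \<open>auto simp: admissible_def\<close>)
    next
      case False
      then have "int n \<le> i + j" by simp
      then have "real_of_int (int n) \<le> real_of_int (i + j)" by (simp only: of_int_le_iff)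
      then have "u = 0" "v = 0" "i + j = int n" using le uv by linarith+
      then have "lattice n i j" using ij by (simp add: lattice_def)
      moreover have "z = pt n i j"
        using xy \<open>u = 0\<close> \<open>v = 0\<close> assms(2) by (intro frame_eqI) (simp_all add: field_simps)
      ultimately show thesis using that(1) grid \<open>u = 0\<close> by blast
    qed
  next
    case False
    then have "real_of_int (i + j + 1) < real_of_int (int n)" using le by simp
    then have "i + j + 1 < int n" by (simp only: of_int_less_iff)
    then show thesis
      by (intro that(2)[of "-1" "i + 1" "j + 1" "1 - u" "1 - v"])
         (use False ij uv xy strict in \<open>auto simp: admissible_def\<close>)
  qed
qed

section \<open>Piecewise affine functions and their derivatives\<close>

lemma cx_combination: "cx ((1 - u - v) *\<^sub>R p + u *\<^sub>R q + v *\<^sub>R r) = (1 - u - v) * cx p + u * cx q + v * cx r"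
  and cy_combination: "cy ((1 - u - v) *\<^sub>R p + u *\<^sub>R q + v *\<^sub>R r) = (1 - u - v) * cy p + u * cy q + v * cy r"
  by (simp_all add: cx_def cy_def inner_add_right inner_diff_right algebra_simps)

definition piecewise_affine :: "nat \<Rightarrow> (real^2 \<Rightarrow> real) \<Rightarrow> bool" where
  "piecewise_affine n w \<longleftrightarrow>
     (\<forall>e i j. admissible n e i j \<longrightarrow> (\<exists>g b. \<forall>z\<in>cell n e i j. w z = g \<bullet> z + b))"

lemma piecewise_affine_interpolation:
  fixes u v :: real
  assumes "piecewise_affine n w" "admissible n e i j" "0 < n"
    and uv: "0 \<le> u" "0 \<le> v" "u + v \<le> 1"
    and z: "n * cx z = i + e * u" "n * cy z = j + e * v"
  shows "w z = (1 - u - v) * w (pt n i j) + u * w (pt n (real_of_int (i + e)) j) + v * w (pt n i (real_of_int (j + e)))"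
proof -
  obtain g b where w: "\<And>z. z \<in> cell n e i j \<Longrightarrow> w z = g \<bullet> z + b"
    using assms(1,2) unfolding piecewise_affine_def by blast
  have cz: "cx z = (i + e * u) / n" "cy z = (j + e * v) / n"
    using z \<open>0 < n\<close> by (simp_all add: field_simps)
  have z_eq: "z = (1 - u - v) *\<^sub>R pt n i j + u *\<^sub>R pt n (real_of_int (i + e)) j + v *\<^sub>R pt n i (real_of_int (j + e))"
    by (rule frame_eqI; simp only: cx_combination cy_combination cx_pt cy_pt cz;
        use \<open>0 < n\<close> in \<open>simp add: field_simps\<close>)
  have "z \<in> cell n e i j"
    unfolding cell_def convex_hull_3 using uv z_eq by force
  moreover have "pt n i j \<in> cell n e i j" "pt n (real_of_int (i + e)) j \<in> cell n e i j" "pt n i (real_of_int (j + e)) \<in> cell n e i j"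
    unfolding cell_def by (auto intro: hull_inc)
  ultimately show ?thesis
    by (simp add: w) (subst z_eq, simp add: inner_add_right algebra_simps)
qed

lemma piecewise_affine_agree:
  assumes "piecewise_affine n w" "piecewise_affine n w'" "0 < n"
    and "\<And>i j. lattice n i j \<Longrightarrow> w (pt n i j) = w' (pt n i j)"
    and "z \<in> tri"
  shows "w z = w' z"
  using assms(5,3)
proof (cases rule: tri_cases)
  case (2 e i j u v)
  then show ?thesis
    using piecewise_affine_interpolation[OF assms(1) 2(1) assms(3) 2(2-6)]
      piecewise_affine_interpolation[OF assms(2) 2(1) assms(3) 2(2-6)]
      assms(4) admissible_lattice[OF 2(1)] by (metis of_int_add)
qed (use assms(4) in auto)

lemma piecewise_affine_has_derivative:
  assumes w: "piecewise_affine n w" and "0 < n"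
    and "z \<in> tri" "z \<notin> grid n"
  obtains e i j and u v :: real where "admissible n e i j" "0 < u" "0 < v" "u + v < 1"
    "n * cx z = i + e * u" "n * cy z = j + e * v"
    "(w has_derivative (\<lambda>h. (n *\<^sub>R (
        (e * (w (pt n (real_of_int (i + e)) j) - w (pt n i j))) *\<^sub>R d1
        + (e * (w (pt n i (real_of_int (j + e))) - w (pt n i j))) *\<^sub>R d2)) \<bullet> h)) (at z)"
  using assms(3,2)
proof (cases rule: tri_cases)
  case (2 e i j u v)
  let ?w0 = "w (pt n i j)" and ?w1 = "w (pt n (real_of_int (i + e)) j)" and ?w2 = "w (pt n i (real_of_int (j + e)))"
  let ?u = "\<lambda>z. e * (n * cx z - i)" and ?v = "\<lambda>z. e * (n * cy z - j)"
  \<comment> \<open>The open cell in coordinate form. Here \<open>?u\<close> and \<open>?v\<close>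
    extend the local coordinates to the plane, using \<open>e * e = 1\<close>, and \<open>w\<close>
    coincides on this open set with its affine interpolant.\<close>
  define U where "U = {z. 0 < ?u z \<and> 0 < ?v z \<and> ?u z + ?v z < 1}"
  have ee: "real_of_int e * (real_of_int e * x) = x" for x using 2(1) by (auto simp: admissible_def)
  have o: "open U" unfolding U_def
    by (intro open_Collect_conj open_Collect_less continuous_intros)
  have zU: "z \<in> U" using 2 assms(4) by (simp add: U_def ee)
  have eq: "?w0 + ?u z' * (?w1 - ?w0) + ?v z' * (?w2 - ?w0) = w z'" if "z' \<in> U" for z'
    using that piecewise_affine_interpolation[OF w 2(1) \<open>0 < n\<close>, of "?u z'" "?v z'" z']
    by (simp add: U_def ee algebra_simps)
  have "((\<lambda>z. ?w0 + ?u z * (?w1 - ?w0) + ?v z * (?w2 - ?w0)) has_derivative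
      (\<lambda>h. (n *\<^sub>R ((e * (?w1 - ?w0)) *\<^sub>R d1 + (e * (?w2 - ?w0)) *\<^sub>R d2)) \<bullet> h)) (at z)"
    unfolding cx_def cy_def
    by (auto intro!: derivative_eq_intros simp: inner_add_left algebra_simps)
  then have "(w has_derivative
      (\<lambda>h. (n *\<^sub>R ((e * (?w1 - ?w0)) *\<^sub>R d1 + (e * (?w2 - ?w0)) *\<^sub>R d2)) \<bullet> h)) (at z)"
    by (rule has_derivative_transform_within_open[OF _ o zU eq])
  then show ?thesis using 2 assms(4) that by blast
qed (use assms(4) in auto)

lemma pt_eq_iff: "0 < n \<Longrightarrow> pt n s t = pt n s' t' \<longleftrightarrow> s = s' \<and> t = t'"
  by (metis cx_pt cy_pt nonzero_mult_div_cancel_left order_less_irrefl times_divide_eq_right)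

text \<open>The difference quotients of the nodal values along the two edges are the two slopes
  given by \<open>hat_slope_cell\<close>; the second uses the exchanged coordinates.\<close>

lemma hat_has_derivative:
  assumes "piecewise_affine n w" "0 < n" "z \<in> tri" "z \<notin> grid n"
    and w: "\<And>i j. lattice n i j \<Longrightarrow> w (pt n i j) = of_bool (i = i0 \<and> j = j0)"
  shows "(w has_derivative (\<lambda>h. hat_grad n i0 j0 z \<bullet> h)) (at z)"
  using assms(1-4)
proof (rule piecewise_affine_has_derivative)
  fix e i j :: int and u v :: real
  assume adm: "admissible n e i j" and uv: "0 < u" "0 < v" "u + v < 1"
    and z: "n * cx z = i + e * u" "n * cy z = j + e * v"
    and deriv: "(w has_derivative (\<lambda>h. (n *\<^sub>R (
        (e * (w (pt n (real_of_int (i + e)) j) - w (pt n i j))) *\<^sub>R d1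
        + (e * (w (pt n i (real_of_int (j + e))) - w (pt n i j))) *\<^sub>R d2)) \<bullet> h)) (at z)"
  have e: "e = 1 \<or> e = -1" using adm by (auto simp: admissible_def)
  have vu: "v + u < 1" using uv by simp
  have vals: "w (pt n i j) = of_bool (i = i0 \<and> j = j0)"
      "w (pt n (real_of_int (i + e)) j) = of_bool (i + e = i0 \<and> j = j0)"
      "w (pt n i (real_of_int (j + e))) = of_bool (i = i0 \<and> j + e = j0)"
    using admissible_lattice[OF adm] w[of i j] w[of "i + e" j] w[of i "j + e"] by simp_all
  show ?thesis
    using deriv unfolding hat_grad_def z vals
      hat_slope_cell[OF e uv] hat_slope_cell[OF e uv(2,1) vu]
    by (simp add: conj_commute)
qed

text \<open>This serves nodal functions whose peak lies outside the triangle. The zero derivative is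
  written as an inner product to fit \<open>local_grad\<close>.\<close>

lemma flat_has_derivative:
  assumes "piecewise_affine n w" "0 < n" "z \<in> tri" "z \<notin> grid n"
    and w: "\<And>i j. lattice n i j \<Longrightarrow> w (pt n i j) = 0"
  shows "(w has_derivative (\<lambda>h. 0 \<bullet> h)) (at z)"
  using assms(1-4)
proof (rule piecewise_affine_has_derivative)
  fix e i j :: int and u v :: real
  assume adm: "admissible n e i j" and "0 < u" "0 < v" "u + v < 1"
    and "n * cx z = i + e * u" "n * cy z = j + e * v"
    and deriv: "(w has_derivative (\<lambda>h. (n *\<^sub>R (
        (e * (w (pt n (real_of_int (i + e)) j) - w (pt n i j))) *\<^sub>R d1
        + (e * (w (pt n i (real_of_int (j + e))) - w (pt n i j))) *\<^sub>R d2)) \<bullet> h)) (at z)"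
  have "w (pt n i j) = 0" "w (pt n (real_of_int (i + e)) j) = 0" "w (pt n i (real_of_int (j + e))) = 0"
    using admissible_lattice[OF adm] w[of i j] w[of "i + e" j] w[of i "j + e"] by simp_all
  then show ?thesis using deriv by simp
qed

lemma fe_space_piecewise_affine:
  assumes "tri \<in> T" "w \<in> fe_space \<Omega> (mesh T k)"
  shows "piecewise_affine (2 ^ (k - 1)) w"
  using assms cell_in_mesh[OF assms(1), of k] unfolding piecewise_affine_def fe_space_def by fastforce

end

subsection \<open>The bilinear form on one triangle\<close>

lemma near_multiple:
  fixes a r i :: int
  assumes "0 < r" "\<bar>a - r * i\<bar> \<le> r"
    and "r dvd a"
  shows "\<exists>x\<in>{-1..1}. a = r * (i + x)"
proof -
  from \<open>r dvd a\<close> obtain c where a: "a = r * c" by (auto elim: dvdE)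
  have "\<bar>r * (c - i)\<bar> \<le> r * 1" using assms(2) by (simp add: a right_diff_distrib)
  then have "\<bar>c - i\<bar> \<le> 1" using assms(1) by (simp add: abs_mult)
  then show ?thesis by (intro bexI[of _ "c - i"]) (auto simp: a)
qed

text \<open>The patch meets 3 grid lines in each axis direction and at most 5 in the diagonal one,
  since \<open>a + b\<close> may deviate by \<open>2 * r\<close>. Each line carries at most
  \<open>2 * r + 1\<close> points, and \<open>11 * (2 * r + 1) \<le> 33 * r\<close>.\<close>

lemma card_near_skeleton:
  fixes r i j :: int
  assumes "0 < r"
  defines "S \<equiv> {(a, b). \<bar>a - r * i\<bar> \<le> r \<and> \<bar>b - r * j\<bar> \<le> r \<and> (r dvd a \<or> r dvd b \<or> r dvd a + b)}"
  shows "finite S" "card S \<le> 33 * nat r"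
proof -
  let ?A = "(\<lambda>(x, t). (r * (i + x), r * j + t)) ` ({-1..1} \<times> {-r..r})"
  let ?B = "(\<lambda>(x, s). (r * i + s, r * (j + x))) ` ({-1..1} \<times> {-r..r})"
  let ?C = "(\<lambda>(x, s). (r * i + s, r * (i + j + x) - (r * i + s))) ` ({-2..2} \<times> {-r..r})"
  have "S \<subseteq> ?A \<union> ?B \<union> ?C"
  proof
    fix p assume "p \<in> S"
    then obtain a b where p: "p = (a, b)" and near: "\<bar>a - r * i\<bar> \<le> r" "\<bar>b - r * j\<bar> \<le> r"
      and "r dvd a \<or> r dvd b \<or> r dvd a + b" by (auto simp: S_def)
    then consider "r dvd a" | "r dvd b" | "r dvd a + b" by blast
    then show "p \<in> ?A \<union> ?B \<union> ?C"
    proof cases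
      case 1
      then obtain x where "x \<in> {-1..1}" "a = r * (i + x)"
        using near_multiple[OF assms(1) near(1) 1] by blast
      then have "p \<in> ?A"
        using near by (intro image_eqI[of _ _ "(x, b - r * j)"]) (auto simp: p abs_le_iff)
      then show ?thesis by blast
    next
      case 2
      then obtain x where "x \<in> {-1..1}" "b = r * (j + x)"
        using near_multiple[OF assms(1) near(2) 2] by blast
      then have "p \<in> ?B"
        using near by (intro image_eqI[of _ _ "(x, a - r * i)"]) (auto simp: p abs_le_iff)
      then show ?thesis by blast
    next
      case 3
      then obtain c where c: "a + b = r * c" by (auto elim: dvdE)
      have "\<bar>r * (c - (i + j))\<bar> \<le> r * 2" using near c by (simp add: algebra_simps abs_le_iff)
      then have "\<bar>c - (i + j)\<bar> \<le> 2" using assms(1) by (simp add: abs_mult)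
      moreover have "b = r * c - a" using c by simp
      ultimately have "p \<in> ?C"
        using near by (intro image_eqI[of _ _ "(c - (i + j), a - r * i)"]) (auto simp: p abs_le_iff)
      then show ?thesis by blast
    qed
  qed
  moreover have fin: "finite (?A \<union> ?B \<union> ?C)" by simp
  ultimately show "finite S" by (rule finite_subset)
  have "card S \<le> card (?A \<union> ?B \<union> ?C)" by (rule card_mono[OF fin]) fact
  also have "\<dots> \<le> card ?A + card ?B + card ?C"
    by (intro order.trans[OF card_Un_le] add_right_mono card_Un_le)
  also have "\<dots> \<le> card ({-1..1::int} \<times> {-r..r}) + card ({-1..1::int} \<times> {-r..r}) + card ({-2..2::int} \<times> {-r..r})"
    by (intro add_mono card_image_le) simp_all
  also have "\<dots> = 11 * nat (2 * r + 1)" by (simp add: card_cartesian_product)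
  also have "\<dots> \<le> 33 * nat r" using assms(1) by simp
  finally show "card S \<le> 33 * nat r" .
qed

text \<open>Each coarse coordinate is within 1 of \<open>a div r\<close> or \<open>b div r\<close>,
  which leaves 3 values per coordinate.\<close>

lemma card_near_coarse:
  fixes r a b :: int
  assumes "0 < r"
  defines "S \<equiv> {(i, j). \<bar>a - r * i\<bar> \<le> r \<and> \<bar>b - r * j\<bar> \<le> r}"
  shows "finite S" "card S \<le> 9"
proof -
  have *: "i \<in> {a div r - 1..a div r + 1}" if "\<bar>a - r * i\<bar> \<le> r" for a i
  proof -
    have a: "a = r * (a div r) + a mod r" "0 \<le> a mod r" "a mod r < r"
      using assms(1) by simp_all
    then have "r * i < r * (a div r + 2)" "r * (a div r - 2) < r * i"
      using that unfolding abs_le_iff distrib_left right_diff_distrib by linarith+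
    then have "i < a div r + 2" "a div r - 2 < i" using assms(1) by simp_all
    then show ?thesis by auto
  qed
  have "S \<subseteq> {a div r - 1..a div r + 1} \<times> {b div r - 1..b div r + 1}"
    using * unfolding S_def by fast
  then show "finite S" and "card S \<le> 9"
    using card_mono[of "{a div r - 1..a div r + 1} \<times> {b div r - 1..b div r + 1}" S]
    by (auto simp: card_cartesian_product intro: finite_subset)
qed

lemma nodal_basisE:
  assumes "w \<in> nodal_basis \<Omega> T"
  obtains p where "w \<in> fe_space \<Omega> T" "p \<in> mesh_vertices T" "w p = 1"
    "\<And>q. q \<in> mesh_vertices T \<Longrightarrow> w q = of_bool (q = p)"
  using assms that unfolding nodal_basis_def by (force split: if_splits)

context triangle_frame
begin

section \<open>Nodal basis functions seen from one initial triangle\<close>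

definition node :: "nat \<Rightarrow> (real^2 \<Rightarrow> real) \<Rightarrow> int \<times> int \<Rightarrow> bool" where
  "node n w p \<longleftrightarrow> lattice n (fst p) (snd p) \<and> w (pt n (fst p) (snd p)) = 1"

definition node_of :: "nat \<Rightarrow> (real^2 \<Rightarrow> real) \<Rightarrow> int \<times> int" where
  "node_of n w = (SOME p. node n w p)"

text \<open>Built only from the lattice position of the peak, hence Borel on the whole plane, unlike
  the pointwise gradient of \<open>w\<close>. The case distinction guards the unspecified value of
  \<open>node_of\<close> when the triangle contains no peak.\<close>

definition local_grad :: "nat \<Rightarrow> (real^2 \<Rightarrow> real) \<Rightarrow> real^2 \<Rightarrow> real^2" where
  "local_grad n w z =
     (if \<exists>p. node n w p then hat_grad n (fst (node_of n w)) (snd (node_of n w)) z else 0)"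

definition local_inner :: "nat \<Rightarrow> (real^2 \<Rightarrow> real) \<Rightarrow> nat \<Rightarrow> (real^2 \<Rightarrow> real) \<Rightarrow> real" where
  "local_inner n w m w' = (LINT z|lborel. indicator tri z * (local_grad n w z \<bullet> local_grad m w' z))"

lemma node_node_of: "\<exists>p. node n w p \<Longrightarrow> node n w (node_of n w)"
  unfolding node_of_def by (rule someI_ex)

lemma local_inner_eq_0: "\<not> ((\<exists>p. node n w p) \<and> (\<exists>p. node m w' p)) \<Longrightarrow> local_inner n w m w' = 0"
  by (auto simp: local_inner_def local_grad_def)

lemma local_inner_eq_hat_inner:
  assumes "\<exists>p. node n w p" "\<exists>p. node m w' p"
  shows "local_inner n w m w' =
    hat_inner n (fst (node_of n w)) (snd (node_of n w)) m (fst (node_of m w')) (snd (node_of m w'))"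
  using assms by (simp add: local_inner_def local_grad_def hat_inner_def)

lemma integrable_local_inner:
  assumes "0 < n" "0 < m"
  shows "integrable lborel (\<lambda>z. indicator tri z * (local_grad n w z \<bullet> local_grad m w' z))"
proof -
  have "local_grad n w = hat_grad n (fst (node_of n w)) (snd (node_of n w)) \<or> local_grad n w = (\<lambda>_. 0)" for n w
    by (simp add: local_grad_def fun_eq_iff)
  from this[of n w] this[of m w'] show ?thesis
    using integrable_hat_inner[of "real n" "real m"] assms by (elim disjE) simp_all
qed

lemma nodal_has_derivative:
  assumes "tri \<in> T" "w \<in> nodal_basis \<Omega> (mesh T k)" and z: "z \<in> tri" "z \<notin> grid (2 ^ (k - 1))"
  shows "(w has_derivative (\<lambda>h. local_grad (2 ^ (k - 1)) w z \<bullet> h)) (at z)"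
proof -
  obtain p where w: "w \<in> fe_space \<Omega> (mesh T k)" "p \<in> mesh_vertices (mesh T k)" "w p = 1"
      and delta: "\<And>q. q \<in> mesh_vertices (mesh T k) \<Longrightarrow> w q = of_bool (q = p)"
    using assms(2) by (rule nodal_basisE) blast
  let ?n = "2 ^ (k - 1) :: nat"
  have vals: "w (pt ?n i j) = of_bool (pt ?n i j = p)" if "lattice ?n i j" for i j
    using delta[OF lattice_mesh_vertex[OF assms(1) that]] by simp
  note aff = fe_space_piecewise_affine[OF assms(1) w(1)]
  show ?thesis
  proof (cases "\<exists>p. node ?n w p")
    case True
    then have node: "node ?n w (node_of ?n w)" by (rule node_node_of)
    obtain i0 j0 where ij: "node_of ?n w = (i0, j0)" by fastforce
    then have "p = pt ?n i0 j0" "lattice ?n i0 j0"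
      using node vals by (auto simp: node_def split: if_splits)
    then have "w (pt ?n i j) = of_bool (i = i0 \<and> j = j0)" if "lattice ?n i j" for i j
      using vals[OF that] by (simp add: pt_eq_iff)
    then have "(w has_derivative (\<lambda>h. hat_grad ?n i0 j0 z \<bullet> h)) (at z)"
      by (intro hat_has_derivative[OF aff _ z]) simp_all
    then show ?thesis unfolding local_grad_def if_P[OF True] ij fst_conv snd_conv .
  next
    case False
    then have "w (pt ?n i j) = 0" if "lattice ?n i j" for i j
      using vals[OF that] that unfolding node_def by (metis fst_conv snd_conv of_bool_def)
    then have "(w has_derivative (\<lambda>h. 0 \<bullet> h)) (at z)"
      by (intro flat_has_derivative[OF aff _ z]) simp_all
    then show ?thesis using False by (simp add: local_grad_def)
  qed
qed

text \<open>Without a peak in the triangle all lattice values vanish, and with them the interpolant.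
  So any triangle where \<open>w\<close> is nonzero somewhere can supply the lower energy
  bound.\<close>

lemma nodal_peak_node:
  assumes "tri \<in> T" "w \<in> nodal_basis \<Omega> (mesh T k)" and z: "z \<in> tri" "w z \<noteq> 0"
  shows "\<exists>p. node (2 ^ (k - 1)) w p"
proof (rule ccontr)
  let ?n = "2 ^ (k - 1) :: nat"
  obtain p where w: "w \<in> fe_space \<Omega> (mesh T k)"
      and delta: "\<And>q. q \<in> mesh_vertices (mesh T k) \<Longrightarrow> w q = of_bool (q = p)"
    using assms(2) by (rule nodal_basisE) blast
  assume no: "\<not> (\<exists>p. node ?n w p)"
  have "w z = (\<lambda>_. 0) z"
  proof (rule piecewise_affine_agree[OF fe_space_piecewise_affine[OF assms(1) w]])
    show "piecewise_affine ?n (\<lambda>_. 0)"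
      unfolding piecewise_affine_def by (intro allI impI exI[of _ 0]) simp
    show "w (pt ?n i j) = 0" if "lattice ?n i j" for i j
    proof -
      have "w (pt ?n i j) \<noteq> 1" using no that unfolding node_def by (metis fst_conv snd_conv)
      then show ?thesis using delta[OF lattice_mesh_vertex[OF assms(1) that]]
        by (simp split: if_splits)
    qed
  qed (use z in auto)
  then show False using z by simp
qed

lemma local_inner_self_lower:
  "\<exists>c>0. \<forall>n w. 0 < n \<longrightarrow> (\<exists>p. node n w p) \<longrightarrow> c \<le> local_inner n w n w"
proof -
  obtain c where "c > 0" and c: "\<And>n i j. \<lbrakk>0 < n; 0 \<le> i; 0 \<le> j; i + j \<le> int n\<rbrakk>
      \<Longrightarrow> c \<le> hat_inner (real n) i j (real n) i j"
    using hat_inner_self_lower by blast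
  have "c \<le> local_inner n w n w" if "0 < n" "\<exists>p. node n w p" for n w
    unfolding local_inner_eq_hat_inner[OF that(2) that(2)]
    using node_node_of[OF that(2)] that(1) by (intro c) (auto simp: node_def lattice_def)
  then show ?thesis using \<open>c > 0\<close> by blast
qed

lemma local_inner_nonzeroD:
  assumes "0 < n" "0 < r" "local_inner n w (n * r) w' \<noteq> 0"
  obtains i j i' j' where "node n w (i, j)" "node (n * r) w' (i', j')"
    "node_of n w = (i, j)" "node_of (n * r) w' = (i', j')"
    "\<bar>i' - int r * i\<bar> \<le> int r" "\<bar>j' - int r * j\<bar> \<le> int r"
    "int r dvd i' \<or> int r dvd j' \<or> int r dvd i' + j'"
proof -
  have nodes: "\<exists>p. node n w p" "\<exists>p. node (n * r) w' p"
    using local_inner_eq_0 assms(3) by blast+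
  obtain i j i' j' where eq: "node_of n w = (i, j)" "node_of (n * r) w' = (i', j')" by fastforce
  then have node: "node n w (i, j)" "node (n * r) w' (i', j')"
    using node_node_of[OF nodes(1)] node_node_of[OF nodes(2)] by simp_all
  have ne: "hat_inner n i j (real n * r) i' j' \<noteq> 0"
    using assms(3) unfolding local_inner_eq_hat_inner[OF nodes] eq by simp
  have "\<bar>real_of_int i' - real r * i\<bar> < 1 + real r" "\<bar>real_of_int j' - real r * j\<bar> < 1 + real r"
    using hat_inner_eq_0_far[OF _ _ ne] assms(1,2) by simp_all
  \<comment> \<open>Both sides are integers, so the strict bound \<open>1 + r\<close> improves to
    \<open>r\<close>, the form needed for counting.\<close>
  then have "real_of_int \<bar>i' - int r * i\<bar> < real_of_int (1 + int r)"
      "real_of_int \<bar>j' - int r * j\<bar> < real_of_int (1 + int r)" by simp_all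
  then have "\<bar>i' - int r * i\<bar> \<le> int r" "\<bar>j' - int r * j\<bar> \<le> int r"
    by (simp_all only: of_int_less_iff)
  moreover have "int r dvd i' \<or> int r dvd j' \<or> int r dvd i' + j'"
    using hat_inner_eq_0_off_grid[OF assms(1,2), of i' j' i j] ne node(2)
    by (auto simp: node_def lattice_def)
  ultimately show ?thesis using that node eq by blast
qed

text \<open>The hypothesis \<open>unique\<close> makes the index of a basis function recoverable
  from its lattice node, so that counting interacting functions becomes counting lattice
  points.\<close>

lemma local_schur:
  assumes "tri \<in> T"
    and unique: "\<And>k w w' p. \<lbrakk>w \<in> nodal_basis \<Omega> (mesh T k); w' \<in> nodal_basis \<Omega> (mesh T k);
        p \<in> mesh_vertices (mesh T k); w p = 1; w' p = 1\<rbrakk> \<Longrightarrow> w = w'"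
  shows "\<exists>C\<ge>0. \<forall>J (N :: nat \<Rightarrow> nat) \<phi> c d.
    (\<forall>k\<in>{1..J}. inj_on (\<phi> k) {1..N k} \<and> \<phi> k ` {1..N k} \<subseteq> nodal_basis \<Omega> (mesh T k)) \<longrightarrow>
    (\<Sum>k=1..J. \<Sum>i=1..N k.
        \<Sum>(l, j)\<in>{(l, j). l \<in> {1..J} \<and> j \<in> {1..N l} \<and> (l > k \<or> l = k \<and> j > i)}.
          c k i * d l j * local_inner (2 ^ (k - 1)) (\<phi> k i) (2 ^ (l - 1)) (\<phi> l j))
      \<le> C * sqrt (\<Sum>k=1..J. \<Sum>i=1..N k. (c k i)\<^sup>2) * sqrt (\<Sum>l=1..J. \<Sum>j=1..N l. (d l j)\<^sup>2)"
proof -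
  let ?B = "4 * (norm d1 + norm d2)\<^sup>2 * (norm e1 + norm e2)\<^sup>2"
  have inj: "i = i'"
    if "inj_on (\<phi> k) {1..N k}" "\<phi> k ` {1..N k} \<subseteq> nodal_basis \<Omega> (mesh T k)"
      "i \<in> {1..N k}" "i' \<in> {1..N k}" "node (2 ^ (k - 1)) (\<phi> k i) q" "node (2 ^ (k - 1)) (\<phi> k i') q"
    for k i i' q and N :: "nat \<Rightarrow> nat" and \<phi>
  proof -
    have "\<phi> k i = \<phi> k i'"
      using that lattice_mesh_vertex[OF assms(1), of k "fst q" "snd q"]
      by (intro unique[of "\<phi> k i" k "\<phi> k i'" "pt (2 ^ (k - 1)) (fst q) (snd q)"])
         (auto simp: node_def)
    then show ?thesis using that by (auto dest: inj_onD)
  qed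
  show ?thesis
  proof (intro exI[of _ "4 * ?B * 33"] conjI allI impI)
    show "0 \<le> 4 * ?B * 33" by simp
    fix J and N :: "nat \<Rightarrow> nat" and \<phi> c d
    assume \<phi>: "\<forall>k\<in>{1..J}. inj_on (\<phi> k) {1..N k} \<and> \<phi> k ` {1..N k} \<subseteq> nodal_basis \<Omega> (mesh T k)"
    let ?A = "\<lambda>k i l j. local_inner (2 ^ (k - 1)) (\<phi> k i) (2 ^ (l - 1)) (\<phi> l j)"
    have pow: "(2::nat) ^ (l - 1) = 2 ^ (k - 1) * 2 ^ (l - k)" if "1 \<le> k" "k \<le> l" for k l
      using that by (simp flip: power_add)
    show "(\<Sum>k=1..J. \<Sum>i=1..N k.
        \<Sum>(l, j)\<in>{(l, j). l \<in> {1..J} \<and> j \<in> {1..N l} \<and> (l > k \<or> l = k \<and> j > i)}.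
          c k i * d l j * ?A k i l j)
      \<le> 4 * ?B * 33 * sqrt (\<Sum>k=1..J. \<Sum>i=1..N k. (c k i)\<^sup>2) * sqrt (\<Sum>l=1..J. \<Sum>j=1..N l. (d l j)\<^sup>2)"
    \<comment> \<open>With nonvanishing itself as the interaction relation, the zero branch of the
      bound is trivial, and distance and divisibility enter only through the two counts.\<close>
    proof (rule multilevel_schur[where R = "\<lambda>k i l j. ?A k i l j \<noteq> 0"])
      fix k i l j :: nat
      assume kl: "k \<in> {1..J}" "l \<in> {1..J}" "k \<le> l"
      show "\<bar>?A k i l j\<bar> \<le> (if ?A k i l j \<noteq> 0 then ?B / 2 ^ (l - k) else 0)"
      proof (cases "?A k i l j = 0")
        case False
        then have nodes: "\<exists>p. node (2 ^ (k - 1)) (\<phi> k i) p" "\<exists>p. node (2 ^ (l - 1)) (\<phi> l j) p"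
          using local_inner_eq_0 by blast+
        have "\<bar>?A k i l j\<bar> \<le> ?B * (real (2 ^ (k - 1)) / real (2 ^ (l - 1)))"
          unfolding local_inner_eq_hat_inner[OF nodes] by (rule abs_hat_inner_le) simp_all
        also have "real (2 ^ (k - 1)) / real (2 ^ (l - 1)) = 1 / 2 ^ (l - k)"
          using pow[of k l] kl by simp
        finally show ?thesis using False by simp
      qed simp
    next
      fix k i l :: nat
      assume k: "k \<in> {1..J}" and l: "l \<in> {1..J}" and "k \<le> l" and i: "i \<in> {1..N k}"
      let ?n = "2 ^ (k - 1) :: nat" and ?r = "2 ^ (l - k) :: nat"
      obtain i0 j0 where ij: "node_of ?n (\<phi> k i) = (i0, j0)" by fastforce
      let ?S = "{(a, b). \<bar>a - int ?r * i0\<bar> \<le> int ?r \<and> \<bar>b - int ?r * j0\<bar> \<le> int ?r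
          \<and> (int ?r dvd a \<or> int ?r dvd b \<or> int ?r dvd a + b)}"
      let ?f = "\<lambda>j. node_of (2 ^ (l - 1)) (\<phi> l j)"
      let ?Z = "{j \<in> {1..N l}. ?A k i l j \<noteq> 0}"
      have m: "(2::nat) ^ (l - 1) = ?n * ?r" using pow k \<open>k \<le> l\<close> by simp
      have Z: "node (2 ^ (l - 1)) (\<phi> l j) (?f j) \<and> ?f j \<in> ?S" if "j \<in> ?Z" for j
      proof -
        have "local_inner ?n (\<phi> k i) (?n * ?r) (\<phi> l j) \<noteq> 0" using that m by simp
        then show ?thesis
          by (rule local_inner_nonzeroD[rotated 2]) (use ij m in \<open>simp_all\<close>)
      qed
      have "inj_on ?f ?Z"
      proof (rule inj_onI)
        fix j j' assume j: "j \<in> ?Z" "j' \<in> ?Z" and eq: "?f j = ?f j'"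
        show "j = j'"
          by (rule inj[of \<phi> l N j j', OF _ _ _ _ conjunct1[OF Z[OF j(1)]]
                conjunct1[OF Z[OF j(2)], folded eq]])
            (use \<phi> l j in blast)+
      qed
      moreover have "?f ` ?Z \<subseteq> ?S" by (intro image_subsetI conjunct2[OF Z])
      moreover have "finite ?S" by (rule card_near_skeleton(1)) simp
      ultimately have "card ?Z \<le> card ?S" by (rule card_inj_on_le)
      also have "\<dots> \<le> 33 * nat (int ?r)" by (rule card_near_skeleton(2)) simp
      finally have "real (card ?Z) \<le> real (33 * ?r)" unfolding nat_int of_nat_le_iff .
      then show "real (card ?Z) \<le> 33 * 2 ^ (l - k)" by simp
    next
      fix k l j :: nat
      assume k: "k \<in> {1..J}" and l: "l \<in> {1..J}" and "k \<le> l" and j: "j \<in> {1..N l}"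
      let ?n = "2 ^ (k - 1) :: nat" and ?r = "2 ^ (l - k) :: nat"
      obtain a b where ab: "node_of (2 ^ (l - 1)) (\<phi> l j) = (a, b)" by fastforce
      let ?S = "{(i, j). \<bar>a - int ?r * i\<bar> \<le> int ?r \<and> \<bar>b - int ?r * j\<bar> \<le> int ?r}"
      let ?f = "\<lambda>i. node_of ?n (\<phi> k i)"
      let ?Z = "{i \<in> {1..N k}. ?A k i l j \<noteq> 0}"
      have m: "(2::nat) ^ (l - 1) = ?n * ?r" using pow k \<open>k \<le> l\<close> by simp
      have Z: "node ?n (\<phi> k i) (?f i) \<and> ?f i \<in> ?S" if "i \<in> ?Z" for i
      proof -
        have "local_inner ?n (\<phi> k i) (?n * ?r) (\<phi> l j) \<noteq> 0" using that m by simp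
        then show ?thesis
          by (rule local_inner_nonzeroD[rotated 2]) (use ab m in \<open>simp_all\<close>)
      qed
      have "inj_on ?f ?Z"
      proof (rule inj_onI)
        fix i i' assume i: "i \<in> ?Z" "i' \<in> ?Z" and eq: "?f i = ?f i'"
        show "i = i'"
          by (rule inj[of \<phi> k N i i', OF _ _ _ _ conjunct1[OF Z[OF i(1)]]
                conjunct1[OF Z[OF i(2)], folded eq]])
            (use \<phi> k i in blast)+
      qed
      moreover have "?f ` ?Z \<subseteq> ?S" by (intro image_subsetI conjunct2[OF Z])
      moreover have "finite ?S" by (rule card_near_coarse(1)) simp
      ultimately have "card ?Z \<le> card ?S" by (rule card_inj_on_le)
      also have "\<dots> \<le> 9" by (rule card_near_coarse(2)) simp
      finally show "real (card ?Z) \<le> 33" by simp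
    qed simp_all
  qed
qed

end

subsection \<open>Assembly over the initial mesh\<close>

text \<open>Cramer's rule: \<open>d1\<close> and \<open>d2\<close> are the rows of the inverse of
  the matrix with columns \<open>e1\<close>, \<open>e2\<close>. Its determinant \<open>D\<close> is
  nonzero because the vertices are not collinear.\<close>

lemma simplex_frame:
  assumes "2 simplex K"
  obtains a e1 e2 d1 d2 where "triangle_frame e1 e2 d1 d2" "triangle_frame.tri a d1 d2 = K"
proof -
  obtain S where S: "\<not> affine_dependent S" "card S = 3" "K = convex hull S"
    using assms unfolding simplex_def by auto
  then obtain a b c where abc: "S = {a, b, c}" "a \<noteq> b" "a \<noteq> c" "b \<noteq> c"
    by (auto simp: card_3_iff)
  define e1 e2 where "e1 = b - a" and "e2 = c - a"
  define D where "D = e1 $ 1 * e2 $ 2 - e1 $ 2 * e2 $ 1"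
  have "\<not> collinear {b, a, c}"
    using S(1) abc collinear_3_eq_affine_dependent[of b a c] by (auto simp: insert_commute)
  then have nc: "\<not> collinear {0, e1, e2}"
    unfolding e1_def e2_def using collinear_3[of b a c] by (simp add: NO_MATCH_def)
  have "D \<noteq> 0"
  proof
    assume D: "D = 0"
    have "e1 \<noteq> 0" using abc by (simp add: e1_def)
    then consider "e1 $ 1 \<noteq> 0" | "e1 $ 2 \<noteq> 0" by (auto simp: vec_eq_iff forall_2)
    then have "\<exists>t. e2 = t *\<^sub>R e1"
    proof cases
      case 1
      then show ?thesis using D
        by (intro exI[of _ "e2 $ 1 / e1 $ 1"]) (simp add: D_def vec_eq_iff forall_2 field_simps)
    next
      case 2
      then show ?thesis using D
        by (intro exI[of _ "e2 $ 2 / e1 $ 2"]) (simp add: D_def vec_eq_iff forall_2 field_simps)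
    qed
    then show False using nc unfolding collinear_lemma by blast
  qed
  define d1 d2 :: "real^2"
    where "d1 = vector [e2 $ 2 / D, - e2 $ 1 / D]" and "d2 = vector [- e1 $ 2 / D, e1 $ 1 / D]"
  have inner: "d1 \<bullet> h = (e2 $ 2 * h $ 1 - e2 $ 1 * h $ 2) / D"
      "d2 \<bullet> h = (e1 $ 1 * h $ 2 - e1 $ 2 * h $ 1) / D" for h
    by (simp_all add: d1_def d2_def inner_vec_def sum_2 vector_2 diff_divide_distrib)
  have frame: "triangle_frame e1 e2 d1 d2"
  proof
    show "d1 \<bullet> e1 = 1" "d1 \<bullet> e2 = 0" "d2 \<bullet> e1 = 0" "d2 \<bullet> e2 = 1"
      unfolding inner using \<open>D \<noteq> 0\<close> by (simp_all add: D_def mult.commute)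
    show "h = (d1 \<bullet> h) *\<^sub>R e1 + (d2 \<bullet> h) *\<^sub>R e2" for h
    proof -
      have D: "(e2 $ 2 * h $ 1 - e2 $ 1 * h $ 2) * e1 $ k + (e1 $ 1 * h $ 2 - e1 $ 2 * h $ 1) * e2 $ k = D * h $ k" for k
        using exhaust_2[of k] by (auto simp: D_def algebra_simps)
      have h: "h $ k = (e2 $ 2 * h $ 1 - e2 $ 1 * h $ 2) / D * e1 $ k + (e1 $ 1 * h $ 2 - e1 $ 2 * h $ 1) / D * e2 $ k" for k
        using \<open>D \<noteq> 0\<close> by (simp add: D flip: add_divide_distrib)
      show ?thesis
        unfolding inner vec_eq_iff vector_add_component vector_scaleR_component real_scaleR_def
        by (rule allI, rule h)
    qed
  qed
  then interpret triangle_frame a e1 e2 d1 d2 .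
  have "tri = K" unfolding tri_eq_hull S(3) abc(1) by (simp add: e1_def e2_def)
  then show ?thesis by (rule that[OF frame])
qed

text \<open>Both functions have their peak at \<open>p\<close>, hence equal values at all mesh
  vertices. Interpolation on each initial triangle gives equality on the closure of the polygon, and
  outside both are 0.\<close>

lemma nodal_unique:
  assumes T: "triangulation_of T \<Omega>"
    and w: "w \<in> nodal_basis \<Omega> (mesh T k)" "w' \<in> nodal_basis \<Omega> (mesh T k)"
    and p: "p \<in> mesh_vertices (mesh T k)" "w p = 1" "w' p = 1"
  shows "w = w'"
proof
  obtain q where fe: "w \<in> fe_space \<Omega> (mesh T k)"
      and q: "\<And>z. z \<in> mesh_vertices (mesh T k) \<Longrightarrow> w z = of_bool (z = q)"
    using w(1) by (rule nodal_basisE) blast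
  obtain q' where fe': "w' \<in> fe_space \<Omega> (mesh T k)"
      and q': "\<And>z. z \<in> mesh_vertices (mesh T k) \<Longrightarrow> w' z = of_bool (z = q')"
    using w(2) by (rule nodal_basisE) blast
  have eq: "q = q'" using p q[OF p(1)] q'[OF p(1)] by (simp split: if_splits)
  fix z show "w z = w' z"
  proof (cases "z \<in> closure \<Omega>")
    case True
    then obtain K where K: "K \<in> T" "z \<in> K" "2 simplex K"
      using T unfolding triangulation_of_def by blast
    obtain a e1 e2 d1 d2 where "triangle_frame e1 e2 d1 d2" and tri: "triangle_frame.tri a d1 d2 = K"
      using simplex_frame[OF K(3)] .
    then interpret triangle_frame a e1 e2 d1 d2 by blast
    have triT: "tri \<in> T" and z: "z \<in> tri" using K tri by simp_all
    let ?n = "2 ^ (k - 1) :: nat"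
    have "w (pt ?n i j) = w' (pt ?n i j)" if "lattice ?n i j" for i j
      using lattice_mesh_vertex[OF triT that] by (simp add: q q' eq)
    then show ?thesis
      by (intro piecewise_affine_agree[OF fe_space_piecewise_affine[OF triT fe]
            fe_space_piecewise_affine[OF triT fe'] _ _ z]) simp_all
  next
    case False
    then show ?thesis using fe fe' by (simp add: fe_space_def)
  qed
qed

text \<open>The data extracted from one triangle \<open>K\<close> of the initial mesh: a representative \<open>G k w\<close> of the
  gradient on \<open>K\<close> of a nodal function \<open>w\<close> of level \<open>k\<close>, the constant \<open>C\<close> of the strengthened
  Cauchy-Schwarz inequality on \<open>K\<close>, and a lower bound \<open>c\<close> for the local energy.\<close>

locale local_model =
  fixes \<Omega> :: "(real^2) set" and T :: "(real^2) set set" and K :: "(real^2) set"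
    and G :: "nat \<Rightarrow> (real^2 \<Rightarrow> real) \<Rightarrow> real^2 \<Rightarrow> real^2" and C c :: real
  assumes C_nonneg: "0 \<le> C" and c_pos: "0 < c"
    and has_derivative: "w \<in> nodal_basis \<Omega> (mesh T k) \<Longrightarrow>
      AE z in lebesgue. z \<in> K \<longrightarrow> (w has_derivative (\<lambda>h. G k w z \<bullet> h)) (at z)"
    and integrable: "integrable lborel (\<lambda>z. indicator K z * (G k w z \<bullet> G l w' z))"
    and lower: "\<lbrakk>w \<in> nodal_basis \<Omega> (mesh T k); p \<in> K; w p \<noteq> 0\<rbrakk> \<Longrightarrow>
      c \<le> (LINT z|lborel. indicator K z * (G k w z \<bullet> G k w z))"
    and schur: "(\<And>k. k \<in> {1..J} \<Longrightarrow> inj_on (\<phi> k) {1..N k} \<and> \<phi> k ` {1..N k} \<subseteq> nodal_basis \<Omega> (mesh T k)) \<Longrightarrow>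
      (\<Sum>k=1..J. \<Sum>i=1..(N k :: nat).
        \<Sum>(l, j)\<in>{(l, j). l \<in> {1..J} \<and> j \<in> {1..N l} \<and> (l > k \<or> l = k \<and> j > i)}.
          x k i * y l j * (LINT z|lborel. indicator K z * (G k (\<phi> k i) z \<bullet> G l (\<phi> l j) z)))
      \<le> C * sqrt (\<Sum>k=1..J. \<Sum>i=1..N k. (x k i)\<^sup>2) * sqrt (\<Sum>l=1..J. \<Sum>j=1..N l. (y l j)\<^sup>2)"

text \<open>Packaging hides the affine frame, which changes with \<open>K\<close>, so that the data
  of all triangles can be chosen simultaneously.\<close>

lemma local_model_exists:
  assumes T: "triangulation_of T \<Omega>" and K: "K \<in> T"
  shows "\<exists>G C c. local_model \<Omega> T K G C c"
proof -
  have "2 simplex K" using assms by (simp add: triangulation_of_def)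
  then obtain a e1 e2 d1 d2 where "triangle_frame e1 e2 d1 d2" and tri: "triangle_frame.tri a d1 d2 = K"
    by (rule simplex_frame)
  then interpret triangle_frame a e1 e2 d1 d2 by blast
  have triT: "tri \<in> T" using K tri by simp
  let ?G = "\<lambda>k. local_grad (2 ^ (k - 1))"
  have "\<exists>C\<ge>0. \<forall>J (N :: nat \<Rightarrow> nat) \<phi> x y.
    (\<forall>k\<in>{1..J}. inj_on (\<phi> k) {1..N k} \<and> \<phi> k ` {1..N k} \<subseteq> nodal_basis \<Omega> (mesh T k)) \<longrightarrow>
    (\<Sum>k=1..J. \<Sum>i=1..N k.
        \<Sum>(l, j)\<in>{(l, j). l \<in> {1..J} \<and> j \<in> {1..N l} \<and> (l > k \<or> l = k \<and> j > i)}.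
          x k i * y l j * local_inner (2 ^ (k - 1)) (\<phi> k i) (2 ^ (l - 1)) (\<phi> l j))
      \<le> C * sqrt (\<Sum>k=1..J. \<Sum>i=1..N k. (x k i)\<^sup>2) * sqrt (\<Sum>l=1..J. \<Sum>j=1..N l. (y l j)\<^sup>2)"
    (is "\<exists>C\<ge>0. ?P C")
    by (rule local_schur[OF triT]) (rule nodal_unique[OF T])
  then obtain C where "0 \<le> C" and C: "?P C" by (elim exE conjE) (rule that)
  obtain c where "0 < c" and c: "\<And>n w. 0 < n \<Longrightarrow> \<exists>p. node n w p \<Longrightarrow> c \<le> local_inner n w n w"
    using local_inner_self_lower by blast
  have "local_model \<Omega> T K ?G C c"
  proof
    show "0 \<le> C" "0 < c" by fact+
    show "AE z in lebesgue. z \<in> K \<longrightarrow> (w has_derivative (\<lambda>h. ?G k w z \<bullet> h)) (at z)"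
      if "w \<in> nodal_basis \<Omega> (mesh T k)" for k w
      using AE_not_grid[of "2 ^ (k - 1)"] nodal_has_derivative[OF triT that] tri
      by (auto elim: eventually_mono)
    show "integrable lborel (\<lambda>z. indicator K z * (?G k w z \<bullet> ?G l w' z))" for k w l w'
      using integrable_local_inner[of "2 ^ (k - 1)" "2 ^ (l - 1)"] tri by simp
    show "c \<le> (LINT z|lborel. indicator K z * (?G k w z \<bullet> ?G k w z))"
      if "w \<in> nodal_basis \<Omega> (mesh T k)" "p \<in> K" "w p \<noteq> 0" for k w p
      using c[OF _ nodal_peak_node[OF triT that(1)]] that tri by (simp add: local_inner_def)
  next
    fix J and \<phi> :: "nat \<Rightarrow> nat \<Rightarrow> real^2 \<Rightarrow> real" and N :: "nat \<Rightarrow> nat" and x y :: "nat \<Rightarrow> nat \<Rightarrow> real"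
    assume \<phi>: "\<And>k. k \<in> {1..J} \<Longrightarrow> inj_on (\<phi> k) {1..N k} \<and> \<phi> k ` {1..N k} \<subseteq> nodal_basis \<Omega> (mesh T k)"
    show "(\<Sum>k=1..J. \<Sum>i=1..N k.
        \<Sum>(l, j)\<in>{(l, j). l \<in> {1..J} \<and> j \<in> {1..N l} \<and> (l > k \<or> l = k \<and> j > i)}.
          x k i * y l j * (LINT z|lborel. indicator K z * (?G k (\<phi> k i) z \<bullet> ?G l (\<phi> l j) z)))
      \<le> C * sqrt (\<Sum>k=1..J. \<Sum>i=1..N k. (x k i)\<^sup>2) * sqrt (\<Sum>l=1..J. \<Sum>j=1..N l. (y l j)\<^sup>2)"
      by (rule C[unfolded local_inner_def tri, THEN spec, of J, THEN spec, of N, THEN spec, of \<phi>,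
            THEN spec, of x, THEN spec, of y, THEN mp]) (intro ballI \<phi>)
  qed
  then show ?thesis by (intro exI)
qed

text \<open>Off the null set of all boundaries, a point of the polygon is interior to every triangle
  containing it. By conformity the intersection of two such triangles is a face meeting the relative
  interior of both, hence equal to both.\<close>

lemma AE_indicator_triangulation:
  assumes \<Omega>: "polygon \<Omega>" and T: "triangulation_of T \<Omega>"
  shows "AE z in lebesgue. indicat_real \<Omega> z = (\<Sum>K\<in>T. indicator K z)"
proof -
  have fin: "finite T" and cover: "\<Union>T = closure \<Omega>"
    and face: "\<And>K K'. K \<in> T \<Longrightarrow> K' \<in> T \<Longrightarrow> K \<inter> K' face_of K"
    and simplex: "\<And>K. K \<in> T \<Longrightarrow> 2 simplex K"
    using T unfolding triangulation_of_def triangulation_def by blast+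
  have "negligible (frontier \<Omega>)"
  proof -
    obtain E where "finite E" "frontier \<Omega> = (\<Union>(a, b)\<in>E. closed_segment a b)"
      using \<Omega> unfolding polygon_def by blast
    moreover have "negligible (closed_segment a b)" for a b :: "real^2"
      by (subst negligible_convex_interior) (simp_all add: interior_closed_segment_ge2)
    ultimately show ?thesis by (auto intro!: negligible_Union)
  qed
  moreover have "negligible (\<Union>(frontier ` T))"
    using fin simplex by (auto intro!: negligible_Union negligible_convex_frontier convex_simplex)
  ultimately have null: "frontier \<Omega> \<union> \<Union>(frontier ` T) \<in> null_sets lebesgue"
    by (simp flip: negligible_iff_null_sets)
  show ?thesis
  proof (rule AE_I'[OF null], clarify)
    fix z assume ne: "indicat_real \<Omega> z \<noteq> (\<Sum>K\<in>T. indicator K z)" and nU: "z \<notin> \<Union>(frontier ` T)"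
    show "z \<in> frontier \<Omega>"
    proof (cases "z \<in> \<Omega>")
      case True
      then obtain K where K: "K \<in> T" "z \<in> K" using cover closure_subset by blast
      have int: "z \<in> rel_interior K" if "K \<in> T" "z \<in> K" for K
      proof -
        have "z \<notin> frontier K" using nU that by blast
        then have "z \<in> interior K" using that(2) closure_subset unfolding frontier_def by blast
        then show ?thesis using interior_subset_rel_interior by blast
      qed
      have sub: "K \<inter> K' = K" if "K \<in> T" "K' \<in> T" "z \<in> K" "z \<in> K'" for K K'
        using face_of_disjoint_rel_interior[OF face[OF that(1,2)]] int[OF that(1,3)] that by blast
      have unique: "K' = K" if "K' \<in> T" "z \<in> K'" for K'
        using sub[OF K(1) that(1) K(2) that(2)] sub[OF that(1) K(1) that(2) K(2)] by blast
      have "indicat_real K' z = (if K' = K then 1 else 0)" if "K' \<in> T" for K'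
      proof (cases "K' = K")
        case False
        then have "z \<notin> K'" using unique that by blast
        then show ?thesis using False by simp
      qed (use K in simp)
      then have "(\<Sum>K'\<in>T. indicat_real K' z) = (\<Sum>K'\<in>T. if K' = K then 1 else 0)"
        by (rule sum.cong[OF refl])
      then show ?thesis using ne True K fin by simp
    next
      case False
      then have "(\<Sum>K\<in>T. indicat_real K z) \<noteq> 0" using ne by simp
      then obtain K where "K \<in> T" "indicat_real K z \<noteq> 0" by (rule sum.not_neutral_contains_not_neutral)
      then have "z \<in> K" by (auto simp: indicator_def split: if_splits)
      then have "z \<in> closure \<Omega>" using cover \<open>K \<in> T\<close> by blast
      moreover have "interior \<Omega> = \<Omega>" using \<Omega> by (simp add: polygon_def interior_open)
      ultimately show ?thesis using False by (simp add: frontier_def)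
    qed
  qed
qed

section \<open>Curl inner products and norms on the polygon\<close>

lemma inner_curl: "curl f z \<bullet> curl g z = grad f z \<bullet> grad g z"
  by (simp add: curl_def inner_vec_def sum_2 vector_2)

lemma grad_cmult:
  assumes "(w has_derivative (\<lambda>h. g \<bullet> h)) (at z)"
  shows "grad (\<lambda>x. c * w x) z = c *\<^sub>R g"
  using has_derivative_mult_right[OF assms, of c] by (intro grad_eqI) simp

lemma L2_inner_curl_nodal:
  assumes \<Omega>: "polygon \<Omega>" and T: "triangulation_of T \<Omega>"
    and model: "\<And>K. K \<in> T \<Longrightarrow> local_model \<Omega> T K (G K) (C K) (c K)"
    and w: "w \<in> nodal_basis \<Omega> (mesh T k)" "w' \<in> nodal_basis \<Omega> (mesh T l)"
  shows "L2_inner \<Omega> (curl (\<lambda>x. \<alpha> * w x)) (curl (\<lambda>x. \<beta> * w' x))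
    = (\<Sum>K\<in>T. \<alpha> * \<beta> * (LINT z|lborel. indicator K z * (G K k w z \<bullet> G K l w' z)))"
proof -
  let ?X = "\<lambda>z. curl (\<lambda>x. \<alpha> * w x) z \<bullet> curl (\<lambda>x. \<beta> * w' x) z"
  let ?F = "\<lambda>z. \<Sum>K\<in>T. \<alpha> * \<beta> * (indicator K z * (G K k w z \<bullet> G K l w' z))"
  have fin: "finite T" using T by (simp add: triangulation_of_def triangulation_def)
  have int: "integrable lborel (\<lambda>z. \<alpha> * \<beta> * (indicator K z * (G K k w z \<bullet> G K l w' z)))" if "K \<in> T" for K
    by (intro integrable_mult_right local_model.integrable[OF model[OF that]])
  then have F: "integrable lborel ?F" by (rule Bochner_Integration.integrable_sum)
  then have Fb: "?F \<in> borel_measurable lborel" by (rule borel_measurable_integrable)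
  then have Fm: "?F \<in> borel_measurable lebesgue" by (rule measurable_completion)
  have deriv: "AE z in lebesgue. \<forall>K\<in>T. z \<in> K \<longrightarrow> (w has_derivative (\<lambda>h. G K k w z \<bullet> h)) (at z)"
    "AE z in lebesgue. \<forall>K\<in>T. z \<in> K \<longrightarrow> (w' has_derivative (\<lambda>h. G K l w' z \<bullet> h)) (at z)"
    using local_model.has_derivative[OF model] w by (auto intro!: AE_finite_allI[OF fin])
  have ae: "AE z in lebesgue. ?F z = indicator \<Omega> z *\<^sub>R ?X z"
    using AE_indicator_triangulation[OF \<Omega> T] deriv
  proof eventually_elim
    case (elim z)
    have "indicator \<Omega> z *\<^sub>R ?X z = (\<Sum>K\<in>T. indicator K z * ?X z)"
      using elim(1) by (simp add: sum_distrib_right)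
    also have "\<dots> = ?F z"
    proof (rule sum.cong[OF refl])
      fix K assume "K \<in> T"
      show "indicator K z * ?X z = \<alpha> * \<beta> * (indicator K z * (G K k w z \<bullet> G K l w' z))"
      proof (cases "z \<in> K")
        case True
        have "grad (\<lambda>x. \<alpha> * w x) z = \<alpha> *\<^sub>R G K k w z"
          by (rule grad_cmult) (use elim(2) True \<open>K \<in> T\<close> in blast)
        moreover have "grad (\<lambda>x. \<beta> * w' x) z = \<beta> *\<^sub>R G K l w' z"
          by (rule grad_cmult) (use elim(3) True \<open>K \<in> T\<close> in blast)
        ultimately have "?X z = \<alpha> * \<beta> * (G K k w z \<bullet> G K l w' z)"
          by (simp add: inner_curl)
        then show ?thesis using True by simp
      qed simp
    qed
    finally show ?case by simp
  qed
  have "\<Omega> \<in> sets lebesgue" using \<Omega> by (simp add: polygon_def)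
  then have "L2_inner \<Omega> (curl (\<lambda>x. \<alpha> * w x)) (curl (\<lambda>x. \<beta> * w' x)) = (LINT z|lebesgue. indicator \<Omega> z *\<^sub>R ?X z)"
    unfolding L2_inner_def by (intro integral_restrict_space) simp
  also have "\<dots> = (LINT z|lebesgue. ?F z)"
  proof (rule integral_cong_AE)
    \<comment> \<open>Measurability of the pointwise curls is inherited from the Borel
      representative \<open>?F\<close>: they agree almost everywhere, and Lebesgue measure is
      complete.\<close>
    show "(\<lambda>z. indicator \<Omega> z *\<^sub>R ?X z) \<in> borel_measurable lebesgue"
      by (rule borel_measurable_AE[OF Fm ae])
    show "AE z in lebesgue. indicator \<Omega> z *\<^sub>R ?X z = ?F z"
      using ae by eventually_elim simp
  qed (rule Fm)
  also have "\<dots> = (LINT z|lborel. ?F z)" by (rule integral_completion[OF Fb])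
  also have "\<dots> = (\<Sum>K\<in>T. LINT z|lborel. \<alpha> * \<beta> * (indicator K z * (G K k w z \<bullet> G K l w' z)))"
    using int by (rule Bochner_Integration.integral_sum)
  finally show ?thesis by simp
qed

text \<open>The peak lies in the closure of the polygon, hence in some initial triangle. Only its
  energy is kept, the others being nonnegative; the minimum over the finite mesh makes the constant
  independent of that triangle.\<close>

lemma L2_norm_curl_nodal_lower:
  assumes \<Omega>: "polygon \<Omega>" and T: "triangulation_of T \<Omega>"
    and model: "\<And>K. K \<in> T \<Longrightarrow> local_model \<Omega> T K (G K) (C K) (c K)"
    and w: "w \<in> nodal_basis \<Omega> (mesh T k)"
  shows "Min (c ` T) * \<alpha>\<^sup>2 \<le> (L2_norm \<Omega> (curl (\<lambda>x. \<alpha> * w x)))\<^sup>2"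
proof -
  have fin: "finite T" using T by (simp add: triangulation_of_def triangulation_def)
  let ?A = "\<lambda>K. LINT z|lborel. indicator K z * (G K k w z \<bullet> G K k w z)"
  obtain p where p: "w p = 1" and "w \<in> fe_space \<Omega> (mesh T k)"
    using w by (rule nodal_basisE) blast
  then have "\<forall>x. x \<notin> closure \<Omega> \<longrightarrow> w x = 0" by (simp add: fe_space_def)
  with p have "p \<in> closure \<Omega>" by (metis zero_neq_one)
  then obtain K where K: "K \<in> T" "p \<in> K" using T unfolding triangulation_of_def by blast
  have "Min (c ` T) \<le> c K" using fin K by simp
  also have "\<dots> \<le> ?A K" using w K(2) p by (intro local_model.lower[OF model[OF K(1)]]) auto
  also have "\<dots> \<le> (\<Sum>K\<in>T. ?A K)"
    using fin K(1) by (intro member_le_sum Bochner_Integration.integral_nonneg) auto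
  finally have "Min (c ` T) * \<alpha>\<^sup>2 \<le> (\<Sum>K\<in>T. ?A K) * \<alpha>\<^sup>2"
    by (rule mult_right_mono) simp
  also have "\<dots> = L2_inner \<Omega> (curl (\<lambda>x. \<alpha> * w x)) (curl (\<lambda>x. \<alpha> * w x))"
    using L2_inner_curl_nodal[OF \<Omega> T model w w, of \<alpha> \<alpha>]
    by (simp add: sum_distrib_left power2_eq_square mult.commute)
  also have "\<dots> = (L2_norm \<Omega> (curl (\<lambda>x. \<alpha> * w x)))\<^sup>2"
    unfolding L2_norm_def by (subst real_sqrt_pow2) (auto simp: L2_inner_def intro: Bochner_Integration.integral_nonneg)
  finally show ?thesis .
qed

theorem theorem6p7:
  fixes \<Omega> :: "(real^2) set" and T1 :: "(real^2) set set" and \<sigma> \<mu> :: real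
  assumes "polygon \<Omega>"
    and "triangulation_of T1 \<Omega>"
    and "shape_regular \<sigma> T1"
    and "\<And>k. k \<ge> 1 \<Longrightarrow> quasi_uniform \<mu> (mesh T1 k)"
  defines "N \<equiv> \<lambda>k. fe_dim \<Omega> (mesh T1 k)"
  shows "\<exists>C>0. \<forall>(J::nat) (\<phi> :: nat \<Rightarrow> nat \<Rightarrow> real^2 \<Rightarrow> real)
      (u :: nat \<Rightarrow> nat \<Rightarrow> real^2 \<Rightarrow> real^2) (v :: nat \<Rightarrow> nat \<Rightarrow> real^2 \<Rightarrow> real^2).
    (\<forall>k\<in>{1..J}. bij_betw (\<phi> k) {1..N k} (nodal_basis \<Omega> (mesh T1 k))) \<longrightarrow>
    (\<forall>k\<in>{1..J}. \<forall>i\<in>{1..N k}. u k i \<in> curl_line (\<phi> k i) \<and> v k i \<in> curl_line (\<phi> k i)) \<longrightarrow>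
    (\<Sum>k=1..J. \<Sum>i=1..N k.
        \<Sum>(l, j)\<in>{(l, j). l \<in> {1..J} \<and> j \<in> {1..N l} \<and> (l > k \<or> l = k \<and> j > i)}.
          L2_inner \<Omega> (u k i) (v l j))
      \<le> C * sqrt (\<Sum>k=1..J. \<Sum>i=1..N k. (L2_norm \<Omega> (u k i))\<^sup>2)
          * sqrt (\<Sum>l=1..J. \<Sum>j=1..N l. (L2_norm \<Omega> (v l j))\<^sup>2)"
proof -
  note \<Omega> = assms(1) and T = assms(2)
  have fin: "finite T1" using T by (simp add: triangulation_of_def triangulation_def)
  have "T1 \<noteq> {}" using \<Omega> T unfolding polygon_def triangulation_of_def by auto
  have "\<forall>K\<in>T1. \<exists>G C c. local_model \<Omega> T1 K G C c"
    using local_model_exists[OF T] by simp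
  then obtain G C c where model: "\<And>K. K \<in> T1 \<Longrightarrow> local_model \<Omega> T1 K (G K) (C K) (c K)"
    by (auto dest!: bchoice)
  \<comment> \<open>Both constants are fixed before the levels, the basis enumeration and the
    functions are introduced, and depend only on the polygon and the initial mesh.\<close>
  define S c0 where "S = sum C T1" and "c0 = Min (c ` T1)"
  have "0 \<le> S" unfolding S_def by (intro sum_nonneg local_model.C_nonneg[OF model])
  have "0 < c0" using fin \<open>T1 \<noteq> {}\<close> local_model.c_pos[OF model] by (simp add: c0_def)
  show ?thesis
  \<comment> \<open>The summand 1 ensures positivity, as the local constants are only known to be
    nonnegative.\<close>
  proof (intro exI[of _ "S / c0 + 1"] conjI allI impI)
    show "0 < S / c0 + 1" using \<open>0 \<le> S\<close> \<open>0 < c0\<close> by (simp add: add_nonneg_pos)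
    fix J :: nat and \<phi> :: "nat \<Rightarrow> nat \<Rightarrow> real^2 \<Rightarrow> real"
      and u v :: "nat \<Rightarrow> nat \<Rightarrow> real^2 \<Rightarrow> real^2"
    assume \<phi>: "\<forall>k\<in>{1..J}. bij_betw (\<phi> k) {1..N k} (nodal_basis \<Omega> (mesh T1 k))"
      and uv: "\<forall>k\<in>{1..J}. \<forall>i\<in>{1..N k}. u k i \<in> curl_line (\<phi> k i) \<and> v k i \<in> curl_line (\<phi> k i)"
    let ?P = "\<lambda>k i. {(l, j). l \<in> {1..J} \<and> j \<in> {1..N l} \<and> (l > k \<or> l = k \<and> j > i)}"
    let ?X = "\<Sum>k=1..J. \<Sum>i=1..N k. (L2_norm \<Omega> (u k i))\<^sup>2"
    let ?Y = "\<Sum>l=1..J. \<Sum>j=1..N l. (L2_norm \<Omega> (v l j))\<^sup>2"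
    let ?A = "\<lambda>K k i l j. LINT z|lborel. indicator K z * (G K k (\<phi> k i) z \<bullet> G K l (\<phi> l j) z)"
    \<comment> \<open>Any admissible scalars will do: the norm bound below applies to whichever
      representation is chosen.\<close>
    define x y where "x k i = (SOME a. u k i = curl (\<lambda>z. a * \<phi> k i z))"
      and "y k i = (SOME a. v k i = curl (\<lambda>z. a * \<phi> k i z))" for k i
    have xy: "u k i = curl (\<lambda>z. x k i * \<phi> k i z)" "v k i = curl (\<lambda>z. y k i * \<phi> k i z)"
      if "k \<in> {1..J}" "i \<in> {1..N k}" for k i
    proof -
      have "\<exists>a. u k i = curl (\<lambda>z. a * \<phi> k i z)" "\<exists>a. v k i = curl (\<lambda>z. a * \<phi> k i z)"
        using bspec[OF bspec[OF uv that(1)] that(2)] by (auto simp: curl_line_def)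
      then show "u k i = curl (\<lambda>z. x k i * \<phi> k i z)" "v k i = curl (\<lambda>z. y k i * \<phi> k i z)"
        unfolding x_def y_def by (auto intro: someI_ex)
    qed
    have nodal: "\<phi> k i \<in> nodal_basis \<Omega> (mesh T1 k)" if "k \<in> {1..J}" "i \<in> {1..N k}" for k i
      using \<phi> that by (meson bij_betwE)
    have bounds: "(x k i)\<^sup>2 \<le> (L2_norm \<Omega> (u k i))\<^sup>2 / c0" "(y k i)\<^sup>2 \<le> (L2_norm \<Omega> (v k i))\<^sup>2 / c0"
      if "k \<in> {1..J}" "i \<in> {1..N k}" for k i
      unfolding xy[OF that]
      using L2_norm_curl_nodal_lower[where G = G and C = C and c = c, OF \<Omega> T model nodal[OF that]] \<open>0 < c0\<close>
      by (simp_all add: c0_def pos_le_divide_eq mult.commute)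
    have X: "(\<Sum>k=1..J. \<Sum>i=1..N k. (x k i)\<^sup>2) \<le> ?X / c0"
      unfolding sum_divide_distrib by (intro sum_mono bounds)
    have Y: "(\<Sum>l=1..J. \<Sum>j=1..N l. (y l j)\<^sup>2) \<le> ?Y / c0"
      unfolding sum_divide_distrib by (intro sum_mono bounds)
    have "(\<Sum>k=1..J. \<Sum>i=1..N k. \<Sum>(l, j)\<in>?P k i. L2_inner \<Omega> (u k i) (v l j))
        = (\<Sum>k=1..J. \<Sum>i=1..N k. \<Sum>p\<in>?P k i. \<Sum>K\<in>T1. x k i * y (fst p) (snd p) * ?A K k i (fst p) (snd p))"
    proof (intro sum.cong refl)
      fix k i p assume ki: "k \<in> {1..J}" "i \<in> {1..N k}" and p: "p \<in> ?P k i"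
      obtain l j where lj: "p = (l, j)" "l \<in> {1..J}" "j \<in> {1..N l}" using p by blast
      have "L2_inner \<Omega> (u k i) (v l j) = (\<Sum>K\<in>T1. x k i * y l j * ?A K k i l j)"
        unfolding xy(1)[OF ki] xy(2)[OF lj(2,3)]
        by (rule L2_inner_curl_nodal[where C = C and c = c, OF \<Omega> T model nodal[OF ki] nodal[OF lj(2,3)]])
      then show "(case p of (l, j) \<Rightarrow> L2_inner \<Omega> (u k i) (v l j))
          = (\<Sum>K\<in>T1. x k i * y (fst p) (snd p) * ?A K k i (fst p) (snd p))"
        by (simp add: lj(1))
    qed
    also have "\<dots> = (\<Sum>K\<in>T1. \<Sum>k=1..J. \<Sum>i=1..N k. \<Sum>p\<in>?P k i.
        x k i * y (fst p) (snd p) * ?A K k i (fst p) (snd p))"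
      by (simp only: sum.swap[where A = T1])
    also have "\<dots> \<le> (\<Sum>K\<in>T1. C K * sqrt (\<Sum>k=1..J. \<Sum>i=1..N k. (x k i)\<^sup>2)
        * sqrt (\<Sum>l=1..J. \<Sum>j=1..N l. (y l j)\<^sup>2))"
    proof (rule sum_mono)
      fix K assume "K \<in> T1"
      show "(\<Sum>k=1..J. \<Sum>i=1..N k. \<Sum>p\<in>?P k i.
          x k i * y (fst p) (snd p) * ?A K k i (fst p) (snd p))
        \<le> C K * sqrt (\<Sum>k=1..J. \<Sum>i=1..N k. (x k i)\<^sup>2) * sqrt (\<Sum>l=1..J. \<Sum>j=1..N l. (y l j)\<^sup>2)"
        using local_model.schur[OF model[OF \<open>K \<in> T1\<close>], of J \<phi> N x y] \<phi>
        by (auto simp: bij_betw_def case_prod_beta)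
    qed
    also have "\<dots> = S * sqrt (\<Sum>k=1..J. \<Sum>i=1..N k. (x k i)\<^sup>2) * sqrt (\<Sum>l=1..J. \<Sum>j=1..N l. (y l j)\<^sup>2)"
      by (simp add: S_def sum_distrib_right)
    \<comment> \<open>Only here do coefficients give way to global norms; each of the two square
      roots contributes a factor \<open>1 / sqrt c0\<close>.\<close>
    also have "\<dots> \<le> S * sqrt (?X / c0) * sqrt (?Y / c0)"
      using \<open>0 \<le> S\<close> \<open>0 < c0\<close> X Y
      by (intro mult_mono mult_left_mono real_sqrt_le_mono)
         (auto intro!: sum_nonneg mult_nonneg_nonneg divide_nonneg_pos)
    also have "\<dots> = S / c0 * sqrt ?X * sqrt ?Y"
      using \<open>0 < c0\<close> by (simp add: real_sqrt_divide)
    also have "\<dots> \<le> (S / c0 + 1) * sqrt ?X * sqrt ?Y"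
      by (intro mult_right_mono) (auto intro!: sum_nonneg)
    finally show "(\<Sum>k=1..J. \<Sum>i=1..N k. \<Sum>(l, j)\<in>?P k i. L2_inner \<Omega> (u k i) (v l j))
        \<le> (S / c0 + 1) * sqrt ?X * sqrt ?Y" .
  qed
qed

end
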